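(* Let $\mathbb{A}_n:\Theta_n\to X^X$, $b_n:\Theta_n\to X$ and $L_n:\Theta_n\to(0,\infty)$, $n\in\mathbb{N}$, be such that, for every $n\in\mathbb{N}$, the functions $\mathbb{A}_n(\theta):X\to X$, $\theta\in\Theta_n$, are continuous linear operators, and the mappings $b_n$, $L_n$ and $X\times\Theta_n\ni(x,\theta)\mapsto\mathbb{A}_n(\theta)(x)\in X$ are measurable. Assume that: (B1) $\|\mathbb{A}_n(\theta)\|_{\mathrm{op}}\le L_n(\theta)$ for any $\theta\in\Theta_n$ and $n\in\mathbb{N}$; (B2) for every Borel set $E\subset(0,\infty)$, $\vartheta_n(L_n^{-1}(E))$ does not depend on $n$, and $R:=\int_{\Theta_1}L_1(\theta)\,\vartheta_1(d\theta)<\infty$, $\int_{\Theta_1}\ln L_1(\theta)\,\vartheta_1(d\theta)<0$; and that, for some $n_0\in\mathbb{N}$, $$\sup_{n\ge n_0}\int_{\Theta_n}\|b_n(\theta)\|\,\vartheta_n(d\theta)<\infty.$$ Consider the affine transformations $S_\theta^{(n)}(x):=\mathbb{A}_n(\theta)(x)+b_n(\theta)$ for $x\in X$, $n\in\mathbb{N}$, $\theta\in\Theta_n$. Then there exist a measure $\bar\pi\in\mathcal{M}_1(X)$, a point $x_0\in X$ and constants $\bar q\in(0,1)$, $\bar C\in[0,\infty)$ such that $$d_{BL}\big(\mu\bar P^{(n)},\bar\pi\big)\le\bar C\bar q^{\,n}\Big(1+\int_X\|x-x_0\|\,\mu(dx)\Big)\quad\text{for any }\mu\in\mathcal{M}_{1,1}(X),\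 n\in\mathbb{N},$$ and, in particular, $\mu\bar P^{(n)}$ converges weakly to $\bar\pi$ as $n\to\infty$ for every $\mu\in\mathcal{M}_1(X)$. Moreover, $\bar\pi\in\mathcal{M}_{1,1}(X)$ whenever $n_0=1$ and $R<1$.
   Context: $\{(\Theta_n,\mathcal{A}_n,\vartheta_n)\}_{n\in\mathbb{N}}$ is an arbitrary sequence of probability spaces; $(X,\|\cdot\|)$ is a separable Banach space over $\mathbb{K}\in\{\mathbb{R},\mathbb{C}\}$, with metric $\rho(x,y)=\|x-y\|$ and Borel $\sigma$-field $\mathcal{B}(X)$; $\|\cdot\|_{\mathrm{op}}$ is the operator norm on continuous linear operators $X\to X$; $X^X$ is the set of all maps $X\to X$. $\mathcal{M}_1(X)$ is the set of Borel probability measures on $X$; $\mathcal{M}_{1,1}(X)$ is the set of those with $\int_X\|x\|\,\mu(dx)<\infty$. $d_{BL}(\mu,\nu):=\sup|\int f\,d\mu-\int f\,d\nu|$, the supremum being over all $f:X\to[-1,1]$ that are Lipschitz with constant at most $1$. Weak convergence means convergence of integrals of all bounded continuous functions. $P_n(x,A):=\int_{\Theta_n}\mathbf{1}_A(S_\theta^{(n)}(x))\,\vartheta_n(d\theta)$; $\mu P_n(A):=\int_X P_n(x,A)\,\mu(dx)$; $\mu\bar P^{(n)}:=\mu P_nP_{n-1}\cdots P_1$ (apply $P_n$ first and $P_1$ last). Thus $\mu\bar P^{(n)}$ is the law of $\Psi_n=(S_{\eta_1}^{(1)}\circ\cdots\circ S_{\eta_n}^{(n)})(\Psi_0)$, $\Psi_0\sim\mu$,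 with $\eta_k\sim\vartheta_k$ mutually independent and independent of $\Psi_0$. *)

theory Defs
  imports "HOL-Probability.Probability"
begin

text \<open>A normed space over \<open>\<real>\<close> or \<open>\<complex>\<close>. The library's normed-space classes are real, so the scalar
  multiplication of the ground field is carried explicitly, on top of the underlying real normed
  space. By the Gelfand--Mazur theorem, \<open>\<real>\<close> and \<open>\<complex>\<close> are, up to isometric isomorphism, the only
  instances of \<^class>\<open>real_normed_field\<close>.\<close>

locale normed_space_over = vector_space scl
  for scl :: "'k::real_normed_field \<Rightarrow> 'a::real_normed_vector \<Rightarrow> 'a" +
  assumes norm_scale: "norm (scl c x) = norm c * norm x"
    and scale_of_real: "scl (of_real r) x = r *\<^sub>R x"

definition continuous_linear_operator ::
  "('k::real_normed_field \<Rightarrow> 'a::real_normed_vector \<Rightarrow> 'a) \<Rightarrow> ('a \<Rightarrow> 'a) \<Rightarrow> bool" where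
  "continuous_linear_operator scl T \<longleftrightarrow>
     Vector_Spaces.linear scl scl T \<and> continuous_on UNIV T"

text \<open>The Lebesgue integral with values in the extended reals. The Bochner integral would give the
  value 0 to a function whose integral is \<open>-\<infinity>\<close>.\<close>

definition ext_integral :: "'t measure \<Rightarrow> ('t \<Rightarrow> real) \<Rightarrow> ereal" where
  "ext_integral M f =
     enn2ereal (\<integral>\<^sup>+t. ennreal (f t) \<partial>M) - enn2ereal (\<integral>\<^sup>+t. ennreal (- f t) \<partial>M)"

definition borel_prob_measures :: "'a::topological_space measure set" where
  "borel_prob_measures = {\<mu>. sets \<mu> = sets borel \<and> prob_space \<mu>}"

definition borel_prob_measures_1 :: "'a::real_normed_vector measure set" where
  "borel_prob_measures_1 =
     {\<mu> \<in> borel_prob_measures. (\<integral>\<^sup>+x. ennreal (norm x) \<partial>\<mu>) < \<infinity>}"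

definition d_BL :: "'a::metric_space measure \<Rightarrow> 'a measure \<Rightarrow> real" where
  "d_BL \<mu> \<nu> =
     (SUP f \<in> {f :: 'a \<Rightarrow> real. range f \<subseteq> {-1..1} \<and> 1-lipschitz_on UNIV f}.
        \<bar>(\<integral>x. f x \<partial>\<mu>) - (\<integral>x. f x \<partial>\<nu>)\<bar>)"

text \<open>The library's \<^const>\<open>weak_conv_m\<close> is restricted to measures on the real line.\<close>

definition converges_weakly ::
  "(nat \<Rightarrow> 'a::topological_space measure) \<Rightarrow> 'a measure \<Rightarrow> bool" where
  "converges_weakly \<mu> \<nu> \<longleftrightarrow>
     (\<forall>f :: 'a \<Rightarrow> real. continuous_on UNIV f \<and> bounded (range f) \<longrightarrow>
        (\<lambda>n. \<integral>x. f x \<partial>\<mu> n) \<longlonglongrightarrow> (\<integral>x. f x \<partial>\<nu>))"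

definition transition_kernel ::
  "'t measure \<Rightarrow> ('t \<Rightarrow> 'a \<Rightarrow> 'a) \<Rightarrow> 'a \<Rightarrow> 'a set \<Rightarrow> ennreal" where
  "transition_kernel M S x A = (\<integral>\<^sup>+\<theta>. indicator A (S \<theta> x) \<partial>M)"

definition apply_kernel ::
  "'a::topological_space measure \<Rightarrow> ('a \<Rightarrow> 'a set \<Rightarrow> ennreal) \<Rightarrow> 'a measure" where
  "apply_kernel \<mu> P = measure_of UNIV (sets borel) (\<lambda>A. \<integral>\<^sup>+x. P x A \<partial>\<mu>)"

lemma emeasure_apply_transition_kernel:
  fixes \<mu> :: "'a::topological_space measure"
  assumes sets: "sets \<mu> = sets borel" and "sigma_finite_measure M"
    and S: "(\<lambda>(x, \<theta>). S \<theta> x) \<in> borel \<Otimes>\<^sub>M M \<rightarrow>\<^sub>M borel" and A: "A \<in> sets borel"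
  shows "emeasure (apply_kernel \<mu> (transition_kernel M S)) A =
           (\<integral>\<^sup>+x. transition_kernel M S x A \<partial>\<mu>)"
proof -
  interpret sigma_finite_measure M by fact
  have S': "(\<lambda>(x, \<theta>). S \<theta> x) \<in> \<mu> \<Otimes>\<^sub>M M \<rightarrow>\<^sub>M borel"
    using S sets by (simp cong: measurable_cong_sets sets_pair_measure_cong)
  have S1: "(\<lambda>\<theta>. S \<theta> x) \<in> M \<rightarrow>\<^sub>M borel" if "x \<in> space \<mu>" for x
    using measurable_Pair2[OF S' that] by simp
  have P: "(\<lambda>x. transition_kernel M S x B) \<in> borel_measurable \<mu>" if "B \<in> sets borel" for B
    unfolding transition_kernel_def
    using that S' by (intro borel_measurable_nn_integral) (auto simp: split_beta')
  have "countably_additive (sets borel) (\<lambda>A. \<integral>\<^sup>+x. transition_kernel M S x A \<partial>\<mu>)"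
  proof (rule countably_additiveI)
    fix B :: "nat \<Rightarrow> 'a set"
    assume B: "range B \<subseteq> sets borel" "disjoint_family B" "(\<Union>i. B i) \<in> sets borel"
    have "(\<Sum>i. transition_kernel M S x (B i)) = transition_kernel M S x (\<Union>i. B i)"
      if "x \<in> space \<mu>" for x
    proof -
      note S1[OF that, measurable]
      have "(\<Sum>i. transition_kernel M S x (B i)) =
          (\<integral>\<^sup>+\<theta>. (\<Sum>i. indicator (B i) (S \<theta> x)) \<partial>M)"
        unfolding transition_kernel_def using B(1)
        by (intro nn_integral_suminf[symmetric]) (auto intro!: measurable_compose[OF S1[OF that]])
      then show ?thesis
        using B(2) by (simp add: suminf_indicator transition_kernel_def)
    qed
    moreover have "(\<Sum>i. \<integral>\<^sup>+x. transition_kernel M S x (B i) \<partial>\<mu>) =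
        (\<integral>\<^sup>+x. (\<Sum>i. transition_kernel M S x (B i)) \<partial>\<mu>)"
      using B(1) P by (intro nn_integral_suminf[symmetric]) auto
    ultimately show "(\<Sum>i. \<integral>\<^sup>+x. transition_kernel M S x (B i) \<partial>\<mu>) =
        (\<integral>\<^sup>+x. transition_kernel M S x (\<Union>i. B i) \<partial>\<mu>)"
      by (simp cong: nn_integral_cong)
  qed
  then show ?thesis
    unfolding apply_kernel_def
    by (intro emeasure_measure_of_sigma A)
       (use sets.sigma_algebra_axioms[of "borel :: 'a measure"] in
          \<open>auto simp: positive_def transition_kernel_def\<close>)
qed

text \<open>\<open>backward_law P n \<mu>\<close> is \<open>\<mu> P\<^sub>n P\<^sub>n\<^sub>-\<^sub>1 \<dots> P\<^sub>1\<close>: the kernel with the largest index acts first.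
  The kernel \<open>P 0\<close> is not used.\<close>

primrec backward_law ::
  "(nat \<Rightarrow> 'a::topological_space \<Rightarrow> 'a set \<Rightarrow> ennreal) \<Rightarrow> nat \<Rightarrow> 'a measure \<Rightarrow> 'a measure" where
  "backward_law P 0 \<mu> = \<mu>"
| "backward_law P (Suc n) \<mu> = backward_law P n (apply_kernel \<mu> (P (Suc n)))"

end

theory Submission
  imports Defs
begin

text \<open>Since \<open>(L\<^sup>s - 1) / s\<close> decreases to \<open>ln L\<close> as \<open>s\<close> decreases to \<open>0\<close>, the negative log-moment yields an
  exponent \<open>s \<in> (0, 1]\<close> with \<open>q = E L\<^sup>s < 1\<close>. All backward laws are realised on one infinite product
  space, where consecutive backward iterates started at the origin differ by at most
  \<open>L\<^sub>1 \<dots> L\<^sub>n \<parallel>b\<^sub>n\<^sub>+\<^sub>1\<parallel>\<close>. By independence the \<open>s\<close>-th moment of this bound is of order \<open>q\<^sup>n\<close>, so the iterates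
  converge almost surely, at a geometric rate in the metric \<open>\<parallel>x - y\<parallel>\<^sup>s\<close>, and the law of the limit is the
  required measure. This rate carries over to \<open>d\<^sub>B\<^sub>L\<close> because a bounded Lipschitz function is
  \<open>s\<close>-Hoelder. If \<open>R < 1\<close>, the same estimate with \<open>s = 1\<close> gives the first moment.\<close>

section \<open>Powers with exponent at most one\<close>

text \<open>The fractions \<open>a / (a + b)\<close> and \<open>b / (a + b)\<close> lie in [0, 1],
  where \<open>c \<le> c powr s\<close>, and they add up to 1. This subadditivity is what lets
  \<open>norm (x - y) powr s\<close> serve as a metric.\<close>

lemma powr_add_le_add_powr:
  fixes a b s :: real
  assumes "0 \<le> a" "0 \<le> b" "s \<le> 1"
  shows "(a + b) powr s \<le> a powr s + b powr s"
proof (cases "a + b = 0")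
  case True
  then show ?thesis using assms by auto
next
  case False
  then have pos: "0 < a + b" using assms by auto
  have *: "c / (a + b) \<le> (c / (a + b)) powr s" if "0 \<le> c" "c \<le> a + b" for c
  proof (cases "c = 0")
    case False
    then show ?thesis
      using powr_mono'[of s 1 "c / (a + b)"] that pos assms by auto
  qed auto
  have "1 = a / (a + b) + b / (a + b)"
    using pos by (simp add: add_divide_distrib[symmetric])
  also have "\<dots> \<le> (a / (a + b)) powr s + (b / (a + b)) powr s"
    using assms by (intro add_mono *) auto
  also have "\<dots> = (a powr s + b powr s) / (a + b) powr s"
    using assms pos by (simp add: powr_divide add_divide_distrib)
  finally show ?thesis
    using pos by (simp add: field_simps)
qed

lemma powr_le_one_plus:
  fixes x s :: real
  assumes "0 \<le> x" "0 < s" "s \<le> 1"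
  shows "x powr s \<le> 1 + x"
proof (cases "x \<le> 1")
  case True
  then have "x powr s \<le> 1" using assms by (simp add: powr_le1)
  then show ?thesis using assms by simp
next
  case False
  then show ?thesis using powr_mono[of s 1 x] assms by simp
qed

text \<open>Convexity of \<open>exp\<close> on the segment from 0 to \<open>ln x\<close>: difference
  quotients of \<open>x powr s\<close> at 0 increase with \<open>s\<close>, and the right-hand side
  is the one for exponent 1.\<close>

lemma powr_minus_one_div_le:
  fixes x s :: real
  assumes "0 < x" "0 < s" "s \<le> 1"
  shows "(x powr s - 1) / s \<le> x - 1"
proof -
  have "exp ((1 - s) *\<^sub>R 0 + s *\<^sub>R ln x) \<le> (1 - s) * exp 0 + s * exp (ln x)"
    using assms by (intro convex_onD[OF exp_convex]) auto
  then have "x powr s \<le> 1 - s + s * x"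
    using assms by (simp add: powr_def mult.commute)
  then show ?thesis using assms by (simp add: field_simps)
qed

text \<open>Along \<open>s = 1 / Suc k\<close>, Fatou's lemma applied to
  \<open>L - (L powr s - 1) / s\<close> bounds the liminf of its expectations below by the
  expectation of \<open>L - ln L\<close>, which exceeds that of \<open>L\<close>. Some
  \<open>k\<close> thus has expectation above that of \<open>L\<close>, and rearranging gives a
  moment below 1.\<close>

lemma exists_powr_moment_less_one:
  fixes L :: "'t \<Rightarrow> real"
  assumes "prob_space M" and [measurable]: "L \<in> borel_measurable M"
    and pos: "\<And>t. t \<in> space M \<Longrightarrow> 0 < L t"
    and fin: "(\<integral>\<^sup>+t. ennreal (L t) \<partial>M) < \<infinity>"
    and neg: "ext_integral M (\<lambda>t. ln (L t)) < 0"
  obtains s where "0 < s" "s \<le> 1" "(\<integral>\<^sup>+t. ennreal (L t powr s) \<partial>M) < 1"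
proof -
  interpret prob_space M by fact
  define s :: "nat \<Rightarrow> real" where "s = (\<lambda>k. 1 / Suc k)"
  have s: "0 < s k" "s k \<le> 1" for k by (auto simp: s_def)
  \<comment> \<open>Subtracting from \<open>L\<close> makes the difference quotients of \<open>L\<^sup>s\<close> at \<open>s = 0\<close> nonnegative, so that Fatou's lemma
    applies; the integral of \<open>ln L\<close> may be \<open>-\<infinity>\<close>.\<close>
  define G where "G = (\<lambda>k t. L t - (L t powr s k - 1) / s k)"
  have G_nonneg: "0 \<le> G k t" if "t \<in> space M" for k t
    using powr_minus_one_div_le[of "L t" "s k"] pos[OF that] s[of k] by (simp add: G_def)
  have [measurable]: "G k \<in> borel_measurable M" for k unfolding G_def by measurable
  have s0: "filterlim s (at 0) sequentially"
  proof (rule filterlim_atI)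
    show "s \<longlonglongrightarrow> 0"
      using LIMSEQ_Suc[OF lim_1_over_n[where ?'a = real]] by (simp add: s_def)
    show "\<forall>\<^sub>F k in sequentially. s k \<noteq> 0"
      using s(1) by (simp add: less_imp_neq[symmetric])
  qed
  have G_lim: "(\<lambda>k. G k t) \<longlonglongrightarrow> L t - ln (L t)" if "t \<in> space M" for t
  proof -
    have "((\<lambda>h. L t powr h) has_real_derivative ln (L t)) (at 0)"
      using pos[OF that] by (auto intro!: derivative_eq_intros)
    then have "((\<lambda>h. (L t powr h - 1) / h) \<longlongrightarrow> ln (L t)) (at 0)"
      using pos[OF that] by (simp add: has_field_derivative_iff)
    from filterlim_compose[OF this s0] show ?thesis
      unfolding G_def by (intro tendsto_intros)
  qed
  let ?Lp = "\<integral>\<^sup>+t. ennreal (ln (L t)) \<partial>M" and ?Ln = "\<integral>\<^sup>+t. ennreal (- ln (L t)) \<partial>M"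
  let ?R = "\<integral>\<^sup>+t. ennreal (L t) \<partial>M"
  have ln_le: "ln (L t) \<le> L t - 1" if "t \<in> space M" for t
    using pos[OF that] by (intro ln_le_minus_one)
  have "?Lp \<le> ?R"
    using ln_le by (intro nn_integral_mono ennreal_leI) force
  then have Lp_fin: "?Lp < \<infinity>" using fin by (rule le_less_trans)
  have less: "?Lp < ?Ln"
  proof (rule ccontr)
    assume "\<not> ?Lp < ?Ln"
    then have "enn2ereal ?Ln \<le> enn2ereal ?Lp" by (simp add: less_eq_ennreal.rep_eq[symmetric] not_less)
    then have "0 \<le> enn2ereal ?Lp - enn2ereal ?Ln"
      using Lp_fin by (intro ereal_diff_positive)
    then show False using neg by (simp add: ext_integral_def not_less[symmetric])
  qed
  let ?G = "\<integral>\<^sup>+t. ennreal (L t - ln (L t)) \<partial>M"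
  \<comment> \<open>\<open>ennreal\<close> cuts off negative values, so \<open>?Lp\<close> and
    \<open>?Ln\<close> are the integrals of the positive and negative parts of \<open>ln L\<close>.
    The identity is stated with sums only, because \<open>?G\<close> and \<open>?Ln\<close> may be
    infinite.\<close>
  have "?G + ?Lp = (\<integral>\<^sup>+t. ennreal (L t - ln (L t)) + ennreal (ln (L t)) \<partial>M)"
    by (simp add: nn_integral_add emeasure_space_1)
  also have "\<dots> = (\<integral>\<^sup>+t. ennreal (L t) + ennreal (- ln (L t)) \<partial>M)"
  proof (intro nn_integral_cong)
    fix t assume t: "t \<in> space M"
    show "ennreal (L t - ln (L t)) + ennreal (ln (L t)) = ennreal (L t) + ennreal (- ln (L t))"
    proof (cases "0 \<le> ln (L t)")
      case True
      then have "ennreal (L t - ln (L t)) + ennreal (ln (L t)) = ennreal (L t - ln (L t) + ln (L t))"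
        using ln_le[OF t] by (intro ennreal_plus[symmetric]) auto
      then show ?thesis using True by (simp add: ennreal_neg)
    next
      case False
      then have "ennreal (L t + (- ln (L t))) = ennreal (L t) + ennreal (- ln (L t))"
        using pos[OF t] by (intro ennreal_plus) auto
      then show ?thesis using False by (simp add: ennreal_neg)
    qed
  qed
  also have "\<dots> = ?R + ?Ln" by (simp add: nn_integral_add)
  finally have eq: "?G + ?Lp = ?R + ?Ln" .
  have "?R < ?G"
  proof (rule ccontr)
    assume "\<not> ?R < ?G"
    then have "?G + ?Lp \<le> ?R + ?Lp" by (intro add_right_mono) auto
    also have "\<dots> < ?R + ?Ln"
      using less fin by (simp add: ennreal_add_left_cancel_less)
    finally show False using eq by simp
  qed
  moreover have "?G \<le> liminf (\<lambda>k. \<integral>\<^sup>+t. ennreal (G k t) \<partial>M)"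
  proof -
    have "?G = (\<integral>\<^sup>+t. liminf (\<lambda>k. ennreal (G k t)) \<partial>M)"
      using G_lim by (intro nn_integral_cong lim_imp_Liminf[symmetric] tendsto_ennrealI) auto
    then show ?thesis using nn_integral_liminf[of "\<lambda>k t. ennreal (G k t)" M] by simp
  qed
  ultimately have "?R < liminf (\<lambda>k. \<integral>\<^sup>+t. ennreal (G k t) \<partial>M)" by (rule less_le_trans)
  then have "\<forall>\<^sub>F k in sequentially. ?R < (\<integral>\<^sup>+t. ennreal (G k t) \<partial>M)" by (rule less_LiminfD)
  then obtain k where k: "?R < (\<integral>\<^sup>+t. ennreal (G k t) \<partial>M)"
    by (auto simp: eventually_sequentially)
  let ?q = "\<integral>\<^sup>+t. ennreal (L t powr s k) \<partial>M"
  \<comment> \<open>The definition of \<open>G\<close> solved for \<open>L + 1 / s\<close> and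
    integrated, again without subtraction. Since \<open>G k\<close> has a larger integral than
    \<open>L\<close>, the factor \<open>?q\<close> must be below 1.\<close>
  have "(\<integral>\<^sup>+t. ennreal (G k t) \<partial>M) + ennreal (1 / s k) * ?q =
      (\<integral>\<^sup>+t. ennreal (G k t) + ennreal (1 / s k) * ennreal (L t powr s k) \<partial>M)"
    by (simp add: nn_integral_add nn_integral_cmult emeasure_space_1)
  also have "\<dots> = (\<integral>\<^sup>+t. ennreal (L t) + ennreal (1 / s k) \<partial>M)"
  proof (intro nn_integral_cong)
    fix t assume t: "t \<in> space M"
    have "ennreal (G k t) + ennreal (1 / s k) * ennreal (L t powr s k)
        = ennreal (G k t + (1 / s k) * (L t powr s k))"
      using G_nonneg[OF t] s[of k] by (subst ennreal_plus) (auto simp only: ennreal_mult zero_le_divide_1_iff powr_ge_zero less_imp_le mult_nonneg_nonneg)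
    also have "G k t + (1 / s k) * (L t powr s k) = L t + 1 / s k"
      using s[of k] by (simp add: G_def field_simps)
    finally show "ennreal (G k t) + ennreal (1 / s k) * ennreal (L t powr s k) = ennreal (L t) + ennreal (1 / s k)"
      using pos[OF t] s[of k] by (simp add: ennreal_plus)
  qed
  also have "\<dots> = ?R + ennreal (1 / s k)"
    by (simp add: nn_integral_add emeasure_space_1)
  finally have eq2: "(\<integral>\<^sup>+t. ennreal (G k t) \<partial>M) + ennreal (1 / s k) * ?q = ?R + ennreal (1 / s k)" .
  have "?q < 1"
  proof (rule ccontr)
    assume "\<not> ?q < 1"
    then have "ennreal (1 / s k) * 1 \<le> ennreal (1 / s k) * ?q" by (intro mult_left_mono) auto
    then have "(\<integral>\<^sup>+t. ennreal (G k t) \<partial>M) + ennreal (1 / s k) \<le> ?R + ennreal (1 / s k)"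
      unfolding eq2[symmetric] by (intro add_left_mono) simp
    then show False using k by (simp add: ennreal_add_left_cancel_le add.commute not_less[symmetric])
  qed
  then show thesis using that s by blast
qed

text \<open>Up to distance 1 the Lipschitz bound \<open>t\<close> is at most
  \<open>t powr s\<close>; beyond distance 1 the oscillation of \<open>f\<close>, at most 2,
  suffices.\<close>

lemma bounded_lipschitz_le_powr:
  fixes f :: "'a::real_normed_vector \<Rightarrow> real"
  assumes "range f \<subseteq> {-1..1}" "1-lipschitz_on UNIV f" and s: "0 < s" "s \<le> 1"
  shows "\<bar>f x - f y\<bar> \<le> 2 * norm (x - y) powr s"
proof (cases "norm (x - y) \<le> 1")
  case True
  have "\<bar>f x - f y\<bar> \<le> norm (x - y)"
    using lipschitz_onD[OF assms(2), of x y] by (simp add: dist_norm)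
  also have "\<dots> \<le> norm (x - y) powr s"
    using powr_mono'[of s 1 "norm (x - y)"] s True by simp
  finally show ?thesis by (simp add: order_trans[OF _ mult_right_mono[of 1 2]])
next
  case False
  then have "1 \<le> norm (x - y) powr s" using s by (intro ge_one_powr_ge_zero) auto
  moreover have "f x \<in> {-1..1}" "f y \<in> {-1..1}" using assms(1) by blast+
  ultimately show ?thesis by auto
qed

text \<open>Almost surely the \<open>s\<close>-th powers are summable. Their terms are then
  eventually below 1, where \<open>f n t\<close> is dominated by its \<open>s\<close>-th
  power.\<close>

lemma AE_summable_of_summable_powr_moments:
  fixes f :: "nat \<Rightarrow> 't \<Rightarrow> real"
  assumes [measurable]: "\<And>n. f n \<in> borel_measurable M"
    and nonneg: "\<And>n t. t \<in> space M \<Longrightarrow> 0 \<le> f n t"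
    and s: "0 < s" "s \<le> 1"
    and fin: "(\<Sum>n. \<integral>\<^sup>+t. ennreal (f n t powr s) \<partial>M) < \<infinity>"
  shows "AE t in M. summable (\<lambda>n. f n t)"
proof -
  have "(\<integral>\<^sup>+t. (\<Sum>n. ennreal (f n t powr s)) \<partial>M) \<noteq> \<infinity>"
    using fin by (subst nn_integral_suminf) auto
  then have "AE t in M. (\<Sum>n. ennreal (f n t powr s)) \<noteq> \<infinity>"
    by (intro nn_integral_PInf_AE) auto
  with AE_space show ?thesis
  proof eventually_elim
    fix t assume t: "t \<in> space M" and "(\<Sum>n. ennreal (f n t powr s)) \<noteq> \<infinity>"
    then have sum: "summable (\<lambda>n. f n t powr s)"
      by (intro summable_suminf_not_top) (auto simp: infinity_ennreal_def)
    then have "(\<lambda>n. f n t powr s) \<longlonglongrightarrow> 0" by (rule summable_LIMSEQ_zero)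
    then have "\<forall>\<^sub>F n in sequentially. f n t powr s < 1" by (rule order_tendstoD) simp
    then have "\<forall>\<^sub>F n in sequentially. norm (f n t) \<le> f n t powr s"
    proof eventually_elim
      case (elim n)
      have "f n t \<le> 1"
      proof (rule ccontr)
        assume "\<not> f n t \<le> 1"
        then have "1 \<le> f n t powr s" using s by (intro ge_one_powr_ge_zero) auto
        then show False using elim by simp
      qed
      then show ?case
        using nonneg[OF t, of n] s powr_mono'[of s 1 "f n t"] by simp
    qed
    then show "summable (\<lambda>n. f n t)"
      using sum by (rule summable_comparison_test_ev)
  qed
qed

text \<open>The usual telescoping estimate for the distance to a limit, carried out in the metric
  \<open>norm (x - y) powr s\<close> by means of \<open>powr_add_le_add_powr\<close>.\<close>

lemma norm_minus_lim_powr_le_suminf: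
  fixes X :: "nat \<Rightarrow> 'a::real_normed_vector"
  assumes lim: "X \<longlonglongrightarrow> z" and d: "\<And>m. norm (X (Suc m) - X m) \<le> d m" and s: "0 < s" "s \<le> 1"
  shows "ennreal (norm (X n - z) powr s) \<le> (\<Sum>m. ennreal (d (m + n) powr s))"
proof -
  have d0: "0 \<le> d m" for m using d[of m] norm_ge_zero order_trans by blast
  have part: "norm (X n - X (k + n)) powr s \<le> (\<Sum>m<k. d (m + n) powr s)" for k
  proof (induction k)
    case (Suc k)
    have "norm (X n - X (Suc k + n)) \<le> norm (X n - X (k + n)) + norm (X (Suc (k + n)) - X (k + n))"
      using norm_triangle_ineq4[of "X n - X (k + n)" "X (Suc (k + n)) - X (k + n)"] by simp
    also have "\<dots> \<le> norm (X n - X (k + n)) + d (k + n)" using d by simp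
    finally have "norm (X n - X (Suc k + n)) powr s \<le> (norm (X n - X (k + n)) + d (k + n)) powr s"
      using s by (intro powr_mono2) auto
    also have "\<dots> \<le> norm (X n - X (k + n)) powr s + d (k + n) powr s"
      using s d0 by (intro powr_add_le_add_powr) auto
    finally show ?case using Suc by simp
  qed simp
  have "ennreal (norm (X n - X (k + n)) powr s) \<le> (\<Sum>m. ennreal (d (m + n) powr s))" for k
  proof -
    have "ennreal (norm (X n - X (k + n)) powr s) \<le> (\<Sum>m<k. ennreal (d (m + n) powr s))"
      using part[of k] by (simp add: sum_ennreal ennreal_leI)
    also have "\<dots> \<le> (\<Sum>m. ennreal (d (m + n) powr s))" by (intro sum_le_suminf) auto
    finally show ?thesis .
  qed
  moreover have "(\<lambda>k. ennreal (norm (X n - X (k + n)) powr s)) \<longlonglongrightarrow> ennreal (norm (X n - z) powr s)"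
    using s LIMSEQ_ignore_initial_segment[OF lim, of n]
    by (intro tendsto_ennrealI tendsto_powr' tendsto_intros) auto
  ultimately show ?thesis by (blast intro: LIMSEQ_le_const2)
qed

lemma suminf_ennreal_geometric_tail:
  assumes "0 \<le> q" "q < 1" "0 \<le> B"
  shows "(\<Sum>m. ennreal (q ^ (m + n) * B)) = ennreal (B * q ^ n / (1 - q))"
proof (rule suminf_ennreal_eq)
  have "(\<lambda>m. B * q ^ n * q ^ m) sums (B * q ^ n * (1 / (1 - q)))"
    using assms by (intro sums_mult geometric_sums) auto
  then show "(\<lambda>m. q ^ (m + n) * B) sums (B * q ^ n / (1 - q))"
    by (simp add: power_add mult_ac)
qed (use assms in auto)

section \<open>Product spaces and laws\<close>

text \<open>By Tonelli, one step of the kernel is the image of an independent pair of state and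
  parameter. This opens the way to realising the laws by random variables.\<close>

lemma apply_transition_kernel_eq_distr:
  fixes \<mu> :: "'a::topological_space measure"
  assumes sets: "sets \<mu> = sets borel" and "sigma_finite_measure M"
    and S: "(\<lambda>(x, \<theta>). S \<theta> x) \<in> borel \<Otimes>\<^sub>M M \<rightarrow>\<^sub>M borel"
  shows "apply_kernel \<mu> (transition_kernel M S) = distr (\<mu> \<Otimes>\<^sub>M M) borel (\<lambda>(x, \<theta>). S \<theta> x)"
proof (rule measure_eqI)
  interpret sigma_finite_measure M by fact
  have S' [measurable]: "(\<lambda>(x, \<theta>). S \<theta> x) \<in> \<mu> \<Otimes>\<^sub>M M \<rightarrow>\<^sub>M borel"
    using S sets by (simp cong: measurable_cong_sets sets_pair_measure_cong)
  show *: "sets (apply_kernel \<mu> (transition_kernel M S)) = sets (distr (\<mu> \<Otimes>\<^sub>M M) borel (\<lambda>(x, \<theta>). S \<theta> x))"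
    using sets.sigma_sets_eq[of "borel :: 'a measure"]
    by (simp add: apply_kernel_def sets_measure_of)
  fix A assume "A \<in> sets (apply_kernel \<mu> (transition_kernel M S))"
  then have A [measurable]: "A \<in> sets borel" unfolding * by simp
  have "emeasure (distr (\<mu> \<Otimes>\<^sub>M M) borel (\<lambda>(x, \<theta>). S \<theta> x)) A
      = (\<integral>\<^sup>+z. indicator A z \<partial>distr (\<mu> \<Otimes>\<^sub>M M) borel (\<lambda>(x, \<theta>). S \<theta> x))"
    by simp
  also have "\<dots> = (\<integral>\<^sup>+z. (\<lambda>(x, \<theta>). indicator A (S \<theta> x)) z \<partial>(\<mu> \<Otimes>\<^sub>M M))"
    by (subst nn_integral_distr) (auto simp: split_beta')
  also have "\<dots> = (\<integral>\<^sup>+x. transition_kernel M S x A \<partial>\<mu>)"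
    unfolding transition_kernel_def using S'
    by (subst nn_integral_fst[symmetric]) (auto simp: split_beta')
  also have "\<dots> = emeasure (apply_kernel \<mu> (transition_kernel M S)) A"
    by (rule emeasure_apply_transition_kernel[symmetric]) (use assms A in auto)
  finally show "emeasure (apply_kernel \<mu> (transition_kernel M S)) A =
     emeasure (distr (\<mu> \<Otimes>\<^sub>M M) borel (\<lambda>(x, \<theta>). S \<theta> x)) A" by simp
qed

text \<open>Overwriting coordinate \<open>i\<close> with a fresh independent sample preserves the
  product measure. The hypothesis \<open>upd\<close> says that the first argument of
  \<open>g\<close> enters only through the other coordinates, so coordinate \<open>i\<close> may be
  integrated separately.\<close>

lemma (in product_prob_space) nn_integral_PiM_coordinate:
  assumes "i \<in> I" and g [measurable]: "g \<in> borel_measurable (Pi\<^sub>M I M \<Otimes>\<^sub>M M i)"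
    and upd: "\<And>\<omega> \<theta> \<theta>'. g (fun_upd \<omega> i \<theta>', \<theta>) = g (\<omega>, \<theta>)"
  shows "(\<integral>\<^sup>+\<omega>. g (\<omega>, \<omega> i) \<partial>Pi\<^sub>M I M) = (\<integral>\<^sup>+\<omega>. \<integral>\<^sup>+\<theta>. g (\<omega>, \<theta>) \<partial>M i \<partial>Pi\<^sub>M I M)"
proof -
  interpret pair: pair_sigma_finite "M i" "Pi\<^sub>M I M" ..
  \<comment> \<open>\<open>distr_pair_PiM_eq_PiM\<close> is phrased for adjoining a coordinate; with
    \<open>i\<close> already in \<open>I\<close> it describes replacing one.\<close>
  have I: "insert i I = I" using \<open>i \<in> I\<close> by auto
  have D: "distr (M i \<Otimes>\<^sub>M Pi\<^sub>M I M) (Pi\<^sub>M I M) (\<lambda>(x, X). fun_upd X i x) = Pi\<^sub>M I M"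
    using distr_pair_PiM_eq_PiM[of I M i] prob_space by (simp add: I)
  have comp [measurable]: "(\<lambda>\<omega>. \<omega> i) \<in> Pi\<^sub>M I M \<rightarrow>\<^sub>M M i"
    using \<open>i \<in> I\<close> by (rule measurable_component_singleton)
  have upd_meas [measurable]: "(\<lambda>(x, X). fun_upd X i x) \<in> M i \<Otimes>\<^sub>M Pi\<^sub>M I M \<rightarrow>\<^sub>M Pi\<^sub>M I M"
    using measurable_fun_upd[of I I i snd "M i \<Otimes>\<^sub>M Pi\<^sub>M I M" M fst]
    by (simp add: split_beta' I)
  have "(\<integral>\<^sup>+\<omega>. g (\<omega>, \<omega> i) \<partial>Pi\<^sub>M I M)
      = (\<integral>\<^sup>+\<omega>. g (\<omega>, \<omega> i) \<partial>distr (M i \<Otimes>\<^sub>M Pi\<^sub>M I M) (Pi\<^sub>M I M) (\<lambda>(x, X). fun_upd X i x))"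
    by (simp add: D)
  also have "\<dots> = (\<integral>\<^sup>+z. (\<lambda>(\<theta>, \<omega>). g (\<omega>, \<theta>)) z \<partial>(M i \<Otimes>\<^sub>M Pi\<^sub>M I M))"
    by (subst nn_integral_distr) (auto simp: split_beta' upd)
  also have "\<dots> = (\<integral>\<^sup>+\<omega>. \<integral>\<^sup>+\<theta>. g (\<omega>, \<theta>) \<partial>M i \<partial>Pi\<^sub>M I M)"
    by (subst pair.nn_integral_snd[symmetric]) auto
  finally show ?thesis .
qed

lemma (in pair_prob_space) distr_pair_snd: "distr (M1 \<Otimes>\<^sub>M M2) M2 snd = M2"
proof (rule measure_eqI)
  fix A assume "A \<in> sets (distr (M1 \<Otimes>\<^sub>M M2) M2 snd)"
  then have A: "A \<in> sets M2" by simp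
  then have "snd -` A \<inter> space (M1 \<Otimes>\<^sub>M M2) = space M1 \<times> A"
    by (auto simp: space_pair_measure dest: sets.sets_into_space)
  with A show "emeasure (distr (M1 \<Otimes>\<^sub>M M2) M2 snd) A = emeasure M2 A"
    by (simp add: emeasure_distr M2.emeasure_pair_measure_Times M1.emeasure_space_1)
qed simp

section \<open>Elementary bounds for the bounded Lipschitz distance\<close>

lemma d_BL_leI:
  fixes \<mu> \<nu> :: "'a::metric_space measure"
  assumes "\<And>f :: 'a \<Rightarrow> real. range f \<subseteq> {-1..1} \<Longrightarrow> 1-lipschitz_on UNIV f \<Longrightarrow>
    \<bar>(\<integral>x. f x \<partial>\<mu>) - (\<integral>x. f x \<partial>\<nu>)\<bar> \<le> c"
  shows "d_BL \<mu> \<nu> \<le> c"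
  unfolding d_BL_def
proof (rule cSUP_least)
  have "(\<lambda>_. 0) \<in> {f :: 'a \<Rightarrow> real. range f \<subseteq> {-1..1} \<and> 1-lipschitz_on UNIV f}"
    by (auto intro!: lipschitz_onI)
  then show "{f :: 'a \<Rightarrow> real. range f \<subseteq> {-1..1} \<and> 1-lipschitz_on UNIV f} \<noteq> {}" by blast
qed (use assms in blast)

text \<open>A crude bound for the finitely many early iterates, for which no rate is
  available.\<close>

lemma d_BL_le_2:
  fixes \<mu> \<nu> :: "'a::metric_space measure"
  assumes "\<mu> \<in> borel_prob_measures" "\<nu> \<in> borel_prob_measures"
  shows "d_BL \<mu> \<nu> \<le> 2"
proof (rule d_BL_leI)
  fix f :: "'a \<Rightarrow> real" assume f: "range f \<subseteq> {-1..1}"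
  have "\<bar>\<integral>x. f x \<partial>M\<bar> \<le> 1" if "M \<in> borel_prob_measures" for M
  proof -
    interpret prob_space M using that by (simp add: borel_prob_measures_def)
    have "-1 \<le> f x" "f x \<le> 1" for x using f by (auto simp: image_subset_iff)
    then have "-1 \<le> (\<integral>x. f x \<partial>M)" "(\<integral>x. f x \<partial>M) \<le> 1" if "integrable M f"
      using that by (auto intro!: integral_ge_const integral_le_const)
    \<comment> \<open>A non-integrable function has Bochner integral 0, so the bound also holds in
      that case.\<close>
    then show ?thesis by (cases "integrable M f") (auto simp: not_integrable_integral_eq)
  qed
  from this[OF assms(1)] this[OF assms(2)]
  show "\<bar>(\<integral>x. f x \<partial>\<mu>) - (\<integral>x. f x \<partial>\<nu>)\<bar> \<le> 2" by linarith
qed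

section \<open>Backward iteration of random Lipschitz maps\<close>

text \<open>The convergence argument uses the affine maps only through their random Lipschitz
  constants. Indices start at 0 here, so \<open>T k\<close> stands for the map
  \<open>S (Suc k)\<close> of the theorem.\<close>

locale random_lipschitz_maps = product_prob_space M "UNIV :: nat set"
  for M :: "nat \<Rightarrow> 't measure" +
  fixes T :: "nat \<Rightarrow> 't \<Rightarrow> 'a \<Rightarrow> 'a::{banach, second_countable_topology}"
    and L :: "nat \<Rightarrow> 't \<Rightarrow> real"
  assumes T_meas: "\<And>k. (\<lambda>(x, \<theta>). T k \<theta> x) \<in> borel \<Otimes>\<^sub>M M k \<rightarrow>\<^sub>M borel"
    and L_meas [measurable]: "\<And>k. L k \<in> borel_measurable (M k)"
    and L_nonneg: "\<And>k \<theta>. \<theta> \<in> space (M k) \<Longrightarrow> 0 \<le> L k \<theta>"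
    and T_lipschitz: "\<And>k \<theta> x y. \<theta> \<in> space (M k) \<Longrightarrow> norm (T k \<theta> x - T k \<theta> y) \<le> L k \<theta> * norm (x - y)"
begin

section \<open>Iterates on the product space: measurability, Lipschitz bounds and laws\<close>

abbreviation \<Omega> :: "(nat \<Rightarrow> 't) measure" where "\<Omega> \<equiv> Pi\<^sub>M UNIV M"

text \<open>Each new map is inserted innermost. Consecutive iterates from one starting point
  therefore differ only in the argument of \<open>backward_map n\<close>, which is why they can
  converge pointwise and not merely in law.\<close>

primrec backward_map :: "nat \<Rightarrow> (nat \<Rightarrow> 't) \<Rightarrow> 'a \<Rightarrow> 'a" where
  "backward_map 0 \<omega> x = x"
| "backward_map (Suc n) \<omega> x = backward_map n \<omega> (T n (\<omega> n) x)"

definition lipschitz_prod :: "nat \<Rightarrow> (nat \<Rightarrow> 't) \<Rightarrow> real" where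
  "lipschitz_prod n \<omega> = (\<Prod>k<n. L k (\<omega> k))"

lemma space_component: "\<omega> \<in> space \<Omega> \<Longrightarrow> \<omega> k \<in> space (M k)"
  by (auto simp: space_PiM)

lemma component_meas [measurable]: "(\<lambda>\<omega>. \<omega> k) \<in> \<Omega> \<rightarrow>\<^sub>M M k"
  by (rule measurable_component_singleton) simp

lemma T_meas' [measurable (raw)]:
  assumes "f \<in> N \<rightarrow>\<^sub>M borel" "g \<in> N \<rightarrow>\<^sub>M M k"
  shows "(\<lambda>z. T k (g z) (f z)) \<in> N \<rightarrow>\<^sub>M borel"
  using measurable_compose[OF measurable_Pair[OF assms] T_meas] by simp

lemma L_meas' [measurable (raw)]:
  assumes "g \<in> N \<rightarrow>\<^sub>M M k"
  shows "(\<lambda>z. L k (g z)) \<in> N \<rightarrow>\<^sub>M borel"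
  using measurable_compose[OF assms L_meas] .

lemma backward_map_meas [measurable (raw)]:
  assumes "f \<in> N \<rightarrow>\<^sub>M borel" and [measurable]: "g \<in> N \<rightarrow>\<^sub>M \<Omega>"
  shows "(\<lambda>z. backward_map n (g z) (f z)) \<in> N \<rightarrow>\<^sub>M borel"
  using assms(1)
proof (induction n arbitrary: f)
  case (Suc n)
  note [measurable] = Suc.prems
  have "(\<lambda>z. T n (g z n) (f z)) \<in> N \<rightarrow>\<^sub>M borel" by measurable
  from Suc.IH[OF this] show ?case by simp
qed simp

lemma lipschitz_prod_meas [measurable]: "lipschitz_prod n \<in> borel_measurable \<Omega>"
  unfolding lipschitz_prod_def by measurable

lemma lipschitz_prod_nonneg: "\<omega> \<in> space \<Omega> \<Longrightarrow> 0 \<le> lipschitz_prod n \<omega>"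
  unfolding lipschitz_prod_def by (intro prod_nonneg ballI L_nonneg space_component)

lemma backward_map_lipschitz:
  assumes "\<omega> \<in> space \<Omega>"
  shows "norm (backward_map n \<omega> x - backward_map n \<omega> y) \<le> lipschitz_prod n \<omega> * norm (x - y)"
proof (induction n arbitrary: x y)
  case 0
  then show ?case by (simp add: lipschitz_prod_def)
next
  case (Suc n)
  have "norm (backward_map (Suc n) \<omega> x - backward_map (Suc n) \<omega> y)
      \<le> lipschitz_prod n \<omega> * norm (T n (\<omega> n) x - T n (\<omega> n) y)"
    using Suc.IH by simp
  also have "\<dots> \<le> lipschitz_prod n \<omega> * (L n (\<omega> n) * norm (x - y))"
    using assms by (intro mult_left_mono T_lipschitz space_component lipschitz_prod_nonneg)
  finally show ?case by (simp add: lipschitz_prod_def mult.assoc)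
qed

text \<open>Only coordinates below \<open>n\<close> are read. This and
  \<open>lipschitz_prod_upd\<close> supply the hypothesis \<open>upd\<close> of
  \<open>nn_integral_PiM_coordinate\<close>, which is how independence enters.\<close>

lemma backward_map_upd: "n \<le> m \<Longrightarrow> backward_map n (fun_upd \<omega> m \<theta>) x = backward_map n \<omega> x"
  by (induction n arbitrary: x) auto

lemma lipschitz_prod_upd: "n \<le> m \<Longrightarrow> lipschitz_prod n (fun_upd \<omega> m \<theta>) = lipschitz_prod n \<omega>"
  unfolding lipschitz_prod_def by (intro prod.cong) auto

text \<open>Induction over all initial laws, since the kernel with the largest index acts first and
  turns \<mu> into the law \<open>\<mu>'\<close> of one random step. Applying the remaining
  \<open>n\<close> maps to that step gives \<open>backward_map (Suc n)\<close>.\<close>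

lemma backward_law_eq_distr:
  assumes P: "\<And>k. P (Suc k) = transition_kernel (M k) (T k)"
    and "\<mu> \<in> borel_prob_measures"
  shows "backward_law P n \<mu> = distr (\<mu> \<Otimes>\<^sub>M \<Omega>) borel (\<lambda>(x, \<omega>). backward_map n \<omega> x)"
  using assms(2)
proof (induction n arbitrary: \<mu>)
  case 0
  then interpret prob_space \<mu> by (simp add: borel_prob_measures_def)
  have "sets \<mu> = sets borel" using 0 by (simp add: borel_prob_measures_def)
  have "distr (\<mu> \<Otimes>\<^sub>M \<Omega>) borel (\<lambda>(x, \<omega>). x) = distr (\<mu> \<Otimes>\<^sub>M \<Omega>) \<mu> fst"
    by (intro distr_cong) (auto simp: \<open>sets \<mu> = sets borel\<close>)
  also have "\<dots> = \<mu>" by (rule P.distr_pair_fst)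
  finally show ?case by simp
next
  case (Suc n)
  then interpret \<mu>: prob_space \<mu> by (simp add: borel_prob_measures_def)
  have sets [measurable_cong]: "sets \<mu> = sets borel" using Suc.prems by (simp add: borel_prob_measures_def)
  define \<mu>' where "\<mu>' = apply_kernel \<mu> (P (Suc n))"
  interpret pair: pair_prob_space \<mu> "M n" ..
  interpret pair': pair_prob_space \<mu> \<Omega> ..
  interpret pair'': pair_prob_space "\<mu> \<Otimes>\<^sub>M M n" \<Omega> ..
  have \<mu>': "\<mu>' = distr (\<mu> \<Otimes>\<^sub>M M n) borel (\<lambda>(x, \<theta>). T n \<theta> x)"
    unfolding \<mu>'_def P by (intro apply_transition_kernel_eq_distr sets T_meas) unfold_locales
  have [measurable_cong]: "sets \<mu>' = sets borel" by (simp add: \<mu>')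
  interpret \<mu>': prob_space \<mu>' unfolding \<mu>' by (intro pair.prob_space_distr) measurable
  interpret pair''': pair_prob_space \<mu>' \<Omega> ..
  have "\<mu>' \<in> borel_prob_measures"
    by (simp add: borel_prob_measures_def \<mu>'.prob_space_axioms) (simp add: \<mu>')
  from Suc.IH[OF this] have "backward_law P (Suc n) \<mu> = distr (\<mu>' \<Otimes>\<^sub>M \<Omega>) borel (\<lambda>(x, \<omega>). backward_map n \<omega> x)"
    by (simp add: \<mu>'_def)
  also have "\<dots> = distr (\<mu> \<Otimes>\<^sub>M \<Omega>) borel (\<lambda>(x, \<omega>). backward_map (Suc n) \<omega> x)"
  proof (rule measure_eqI)
    fix A assume "A \<in> sets (distr (\<mu>' \<Otimes>\<^sub>M \<Omega>) borel (\<lambda>(x, \<omega>). backward_map n \<omega> x))"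
    then have [measurable]: "A \<in> sets borel" by simp
    let ?i = "\<lambda>z. indicator A z :: ennreal"
    have "emeasure (distr (\<mu>' \<Otimes>\<^sub>M \<Omega>) borel (\<lambda>(x, \<omega>). backward_map n \<omega> x)) A
      = (\<integral>\<^sup>+z. ?i z \<partial>(distr (\<mu>' \<Otimes>\<^sub>M \<Omega>) borel (\<lambda>(x, \<omega>). backward_map n \<omega> x)))" by simp
    also have "\<dots> = (\<integral>\<^sup>+z. (\<lambda>(x, \<omega>). ?i (backward_map n \<omega> x)) z \<partial>(\<mu>' \<Otimes>\<^sub>M \<Omega>))"
      by (subst nn_integral_distr) (auto simp: split_beta')
    also have "\<dots> = (\<integral>\<^sup>+\<omega>. \<integral>\<^sup>+x. ?i (backward_map n \<omega> x) \<partial>\<mu>' \<partial>\<Omega>)"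
      by (subst pair'''.nn_integral_snd[symmetric]) auto
    also have "\<dots> = (\<integral>\<^sup>+\<omega>. \<integral>\<^sup>+z. (\<lambda>(x, \<theta>). ?i (backward_map n \<omega> (T n \<theta> x))) z \<partial>(\<mu> \<Otimes>\<^sub>M M n) \<partial>\<Omega>)"
      unfolding \<mu>' by (intro nn_integral_cong, subst nn_integral_distr) (auto simp: split_beta')
    also have "\<dots> = (\<integral>\<^sup>+\<omega>. \<integral>\<^sup>+\<theta>. \<integral>\<^sup>+x. ?i (backward_map n \<omega> (T n \<theta> x)) \<partial>\<mu> \<partial>M n \<partial>\<Omega>)"
      by (intro nn_integral_cong, subst pair.nn_integral_snd[symmetric]) auto
    \<comment> \<open>The separate sample \<theta> becomes coordinate \<open>n\<close> of \<omega>,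
      which is free because \<open>backward_map n\<close> does not read it.\<close>
    also have "\<dots> = (\<integral>\<^sup>+\<omega>. \<integral>\<^sup>+x. ?i (backward_map (Suc n) \<omega> x) \<partial>\<mu> \<partial>\<Omega>)"
    proof -
      let ?g = "\<lambda>(\<omega>, \<theta>). \<integral>\<^sup>+x. ?i (backward_map n \<omega> (T n \<theta> x)) \<partial>\<mu>"
      have "?g \<in> borel_measurable (\<Omega> \<Otimes>\<^sub>M M n)" by measurable
      from nn_integral_PiM_coordinate[OF UNIV_I this] show ?thesis
        by (simp add: backward_map_upd)
    qed
    also have "\<dots> = (\<integral>\<^sup>+z. (\<lambda>(x, \<omega>). ?i (backward_map (Suc n) \<omega> x)) z \<partial>(\<mu> \<Otimes>\<^sub>M \<Omega>))"
      by (subst pair'.nn_integral_snd[symmetric]) auto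
    also have "\<dots> = (\<integral>\<^sup>+z. ?i z \<partial>(distr (\<mu> \<Otimes>\<^sub>M \<Omega>) borel (\<lambda>(x, \<omega>). backward_map (Suc n) \<omega> x)))"
      by (subst nn_integral_distr) (auto simp: split_beta')
    finally show "emeasure (distr (\<mu>' \<Otimes>\<^sub>M \<Omega>) borel (\<lambda>(x, \<omega>). backward_map n \<omega> x)) A =
      emeasure (distr (\<mu> \<Otimes>\<^sub>M \<Omega>) borel (\<lambda>(x, \<omega>). backward_map (Suc n) \<omega> x)) A" by simp
  qed simp
  finally show ?case .
qed

section \<open>Fractional moments of the products of Lipschitz constants\<close>

lemma nn_integral_lipschitz_prod_powr_mult:
  assumes [measurable]: "h \<in> borel_measurable (M n)" and "0 \<le> s"
  shows "(\<integral>\<^sup>+\<omega>. ennreal (lipschitz_prod n \<omega> powr s) * h (\<omega> n) \<partial>\<Omega>)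
       = (\<integral>\<^sup>+\<omega>. ennreal (lipschitz_prod n \<omega> powr s) \<partial>\<Omega>) * (\<integral>\<^sup>+\<theta>. h \<theta> \<partial>M n)"
proof -
  let ?g = "\<lambda>(\<omega>, \<theta>). ennreal (lipschitz_prod n \<omega> powr s) * h \<theta>"
  have "?g \<in> borel_measurable (\<Omega> \<Otimes>\<^sub>M M n)" by measurable
  from nn_integral_PiM_coordinate[OF UNIV_I this] show ?thesis
    by (simp add: lipschitz_prod_upd nn_integral_cmult nn_integral_multc)
qed

lemma nn_integral_lipschitz_prod_powr:
  assumes "0 \<le> s" and q: "\<And>k. (\<integral>\<^sup>+\<theta>. ennreal (L k \<theta> powr s) \<partial>M k) = q"
  shows "(\<integral>\<^sup>+\<omega>. ennreal (lipschitz_prod n \<omega> powr s) \<partial>\<Omega>) = q ^ n"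
proof (induction n)
  case 0
  then show ?case by (simp add: lipschitz_prod_def P.emeasure_space_1)
next
  case (Suc n)
  have "(\<integral>\<^sup>+\<omega>. ennreal (lipschitz_prod (Suc n) \<omega> powr s) \<partial>\<Omega>)
      = (\<integral>\<^sup>+\<omega>. ennreal (lipschitz_prod n \<omega> powr s) * ennreal (L n (\<omega> n) powr s) \<partial>\<Omega>)"
    using lipschitz_prod_nonneg L_nonneg space_component
    by (intro nn_integral_cong) (simp add: ennreal_mult[symmetric] powr_mult lipschitz_prod_def)
  also have "\<dots> = q ^ n * q"
    using assms(1) by (subst nn_integral_lipschitz_prod_powr_mult) (auto simp: Suc q)
  finally show ?case by (simp add: mult.commute)
qed

section \<open>Almost sure limit of the iterates and its distance from them\<close>

definition limit_point :: "(nat \<Rightarrow> 't) \<Rightarrow> 'a" where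
  "limit_point \<omega> = Lim sequentially (\<lambda>n. backward_map n \<omega> 0)"

definition increment_bound :: "nat \<Rightarrow> (nat \<Rightarrow> 't) \<Rightarrow> real" where
  "increment_bound n \<omega> = lipschitz_prod n \<omega> * norm (T n (\<omega> n) 0)"

text \<open>Wherever the iterates diverge, \<open>Lim\<close> takes one and the same unspecified
  value, so the limit is measurable on the whole space.\<close>

lemma limit_point_meas [measurable]: "limit_point \<in> \<Omega> \<rightarrow>\<^sub>M borel"
  unfolding limit_point_def by measurable

lemma increment_bound_meas [measurable]: "increment_bound n \<in> borel_measurable \<Omega>"
  unfolding increment_bound_def by measurable

lemma norm_backward_map_Suc_minus_le:
  assumes "\<omega> \<in> space \<Omega>"
  shows "norm (backward_map (Suc n) \<omega> 0 - backward_map n \<omega> 0) \<le> increment_bound n \<omega>"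
  using backward_map_lipschitz[OF assms, of n "T n (\<omega> n) 0" 0] by (simp add: increment_bound_def)

lemma nn_integral_increment_bound_powr_le:
  assumes s: "0 < s" and q: "0 \<le> q" "\<And>k. (\<integral>\<^sup>+\<theta>. ennreal (L k \<theta> powr s) \<partial>M k) = ennreal q"
    and B: "0 \<le> B" "(\<integral>\<^sup>+\<theta>. ennreal (norm (T n \<theta> 0) powr s) \<partial>M n) \<le> ennreal B"
  shows "(\<integral>\<^sup>+\<omega>. ennreal (increment_bound n \<omega> powr s) \<partial>\<Omega>) \<le> ennreal (q ^ n * B)"
proof -
  have "(\<integral>\<^sup>+\<omega>. ennreal (increment_bound n \<omega> powr s) \<partial>\<Omega>)
      = (\<integral>\<^sup>+\<omega>. ennreal (lipschitz_prod n \<omega> powr s) * ennreal (norm (T n (\<omega> n) 0) powr s) \<partial>\<Omega>)"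
    using lipschitz_prod_nonneg
    by (intro nn_integral_cong) (simp add: increment_bound_def powr_mult ennreal_mult)
  also have "\<dots> = ennreal q ^ n * (\<integral>\<^sup>+\<theta>. ennreal (norm (T n \<theta> 0) powr s) \<partial>M n)"
    using s by (subst nn_integral_lipschitz_prod_powr_mult)
      (auto simp: nn_integral_lipschitz_prod_powr[OF _ q(2)])
  also have "\<dots> \<le> ennreal q ^ n * ennreal B"
    using B by (intro mult_left_mono) auto
  finally show ?thesis using q B by (simp add: ennreal_mult ennreal_power)
qed

text \<open>The \<open>s\<close>-th moments of the increments from \<open>N\<close> on form a
  convergent geometric bound, so the increments are almost surely absolutely summable and
  completeness gives a limit. The same argument makes \<open>lipschitz_prod n\<close> tend to 0,
  which removes the influence of the starting point, for all points outside one null set.\<close>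

lemma AE_backward_map_tendsto:
  assumes s: "0 < s" "s \<le> 1"
    and q: "0 \<le> q" "q < 1" "\<And>k. (\<integral>\<^sup>+\<theta>. ennreal (L k \<theta> powr s) \<partial>M k) = ennreal q"
    and B: "0 \<le> B" "\<And>n. n \<ge> N \<Longrightarrow> (\<integral>\<^sup>+\<theta>. ennreal (norm (T n \<theta> 0) powr s) \<partial>M n) \<le> ennreal B"
  shows "AE \<omega> in \<Omega>. \<forall>x. (\<lambda>n. backward_map n \<omega> x) \<longlonglongrightarrow> limit_point \<omega>"
proof -
  have "(\<Sum>n. \<integral>\<^sup>+\<omega>. ennreal (increment_bound (n + N) \<omega> powr s) \<partial>\<Omega>) \<le> (\<Sum>n. ennreal (q ^ (n + N) * B))"
    using s q B by (intro suminf_le nn_integral_increment_bound_powr_le) auto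
  also have "\<dots> < \<infinity>" using q B by (subst suminf_ennreal_geometric_tail) auto
  finally have "AE \<omega> in \<Omega>. summable (\<lambda>n. increment_bound (n + N) \<omega>)"
    using s lipschitz_prod_nonneg
    by (intro AE_summable_of_summable_powr_moments[where s = s]) (auto simp: increment_bound_def)
  moreover have "(\<Sum>n. \<integral>\<^sup>+\<omega>. ennreal (lipschitz_prod n \<omega> powr s) \<partial>\<Omega>) < \<infinity>"
  proof -
    have "(\<Sum>n. \<integral>\<^sup>+\<omega>. ennreal (lipschitz_prod n \<omega> powr s) \<partial>\<Omega>) = (\<Sum>n. ennreal (q ^ (n + 0) * 1))"
      using s q by (simp add: nn_integral_lipschitz_prod_powr[OF _ q(3)] ennreal_power)
    also have "\<dots> < \<infinity>" using q by (subst suminf_ennreal_geometric_tail) auto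
    finally show ?thesis .
  qed
  then have "AE \<omega> in \<Omega>. summable (\<lambda>n. lipschitz_prod n \<omega>)"
    using s lipschitz_prod_nonneg
    by (intro AE_summable_of_summable_powr_moments[where s = s]) auto
  moreover note AE_space
  ultimately show ?thesis
  proof eventually_elim
    case (elim \<omega>)
    let ?X = "\<lambda>n. backward_map n \<omega> 0"
    have "summable (\<lambda>n. ?X (Suc n + N) - ?X (n + N))"
      using norm_backward_map_Suc_minus_le[OF elim(3)]
      by (intro summable_comparison_test'[OF elim(1), of 0]) simp
    then have "convergent (\<lambda>k. \<Sum>n<k. ?X (Suc n + N) - ?X (n + N))"
      by (simp add: summable_iff_convergent)
    then have "convergent (\<lambda>k. (?X (k + N) - ?X (0 + N)) + ?X (0 + N))"
      unfolding sum_lessThan_telescope[of "\<lambda>n. ?X (n + N)"] by (intro convergent_add convergent_const)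
    then have "convergent (\<lambda>k. ?X (k + N))" by simp
    then have "convergent ?X" using convergent_ignore_initial_segment[of ?X N] by simp
    then have lim: "?X \<longlonglongrightarrow> limit_point \<omega>" unfolding limit_point_def convergent_LIMSEQ_iff .
    show ?case
    proof
      fix x :: 'a
      have "(\<lambda>n. lipschitz_prod n \<omega> * norm (x - 0)) \<longlonglongrightarrow> 0"
        using summable_LIMSEQ_zero[OF elim(2)] by (auto intro!: tendsto_eq_intros)
      then have "(\<lambda>n. backward_map n \<omega> x - backward_map n \<omega> 0) \<longlonglongrightarrow> 0"
        by (rule Lim_null_comparison[rotated])
          (intro always_eventually allI backward_map_lipschitz elim)
      from tendsto_add[OF this lim] show "(\<lambda>n. backward_map n \<omega> x) \<longlonglongrightarrow> limit_point \<omega>" by simp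
    qed
  qed
qed

text \<open>The telescoping bound integrated term by term leaves a geometric tail. General
  \<open>n\<close> yields the rate of convergence; \<open>n = 0\<close> with \<open>s = 1\<close>
  yields the first moment of the limit.\<close>

lemma nn_integral_dist_limit_point_powr_le:
  assumes lim: "AE \<omega> in \<Omega>. (\<lambda>n. backward_map n \<omega> 0) \<longlonglongrightarrow> limit_point \<omega>"
    and s: "0 < s" "s \<le> 1"
    and q: "0 \<le> q" "q < 1" "\<And>k. (\<integral>\<^sup>+\<theta>. ennreal (L k \<theta> powr s) \<partial>M k) = ennreal q"
    and B: "0 \<le> B" "\<And>m. m \<ge> n \<Longrightarrow> (\<integral>\<^sup>+\<theta>. ennreal (norm (T m \<theta> 0) powr s) \<partial>M m) \<le> ennreal B"
  shows "(\<integral>\<^sup>+\<omega>. ennreal (norm (backward_map n \<omega> 0 - limit_point \<omega>) powr s) \<partial>\<Omega>)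
       \<le> ennreal (B * q ^ n / (1 - q))"
proof -
  have "(\<integral>\<^sup>+\<omega>. ennreal (norm (backward_map n \<omega> 0 - limit_point \<omega>) powr s) \<partial>\<Omega>)
      \<le> (\<integral>\<^sup>+\<omega>. (\<Sum>m. ennreal (increment_bound (m + n) \<omega> powr s)) \<partial>\<Omega>)"
    using lim AE_space
    by (intro nn_integral_mono_AE, eventually_elim)
      (intro norm_minus_lim_powr_le_suminf norm_backward_map_Suc_minus_le s)
  also have "\<dots> = (\<Sum>m. \<integral>\<^sup>+\<omega>. ennreal (increment_bound (m + n) \<omega> powr s) \<partial>\<Omega>)"
    by (rule nn_integral_suminf) measurable
  also have "\<dots> \<le> (\<Sum>m. ennreal (q ^ (m + n) * B))"
    using s q B by (intro suminf_le nn_integral_increment_bound_powr_le) auto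
  also have "\<dots> = ennreal (B * q ^ n / (1 - q))"
    using q B by (intro suminf_ennreal_geometric_tail)
  finally show ?thesis .
qed

section \<open>Comparison of the laws of the iterates with the law of the limit\<close>

lemma integral_backward_law:
  fixes f :: "'a \<Rightarrow> real"
  assumes P: "\<And>k. P (Suc k) = transition_kernel (M k) (T k)" and \<mu>: "\<mu> \<in> borel_prob_measures"
    and [measurable]: "f \<in> borel_measurable borel"
  shows "(\<integral>x. f x \<partial>backward_law P n \<mu>) = (\<integral>z. f (backward_map n (snd z) (fst z)) \<partial>(\<mu> \<Otimes>\<^sub>M \<Omega>))"
proof -
  have [measurable_cong]: "sets \<mu> = sets borel" using \<mu> by (simp add: borel_prob_measures_def)
  show ?thesis
    unfolding backward_law_eq_distr[OF P \<mu>] split_beta' by (rule integral_distr) measurable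
qed

text \<open>Lifts the limit law to \<open>\<mu> \<Otimes>\<^sub>M \<Omega>\<close>, where the
  iterates live as well. On this common space the two laws are coupled and their integrals can be
  compared pointwise.\<close>

lemma integral_law_limit_point:
  fixes f :: "'a \<Rightarrow> real"
  assumes "prob_space \<mu>" and [measurable]: "f \<in> borel_measurable borel"
  shows "(\<integral>x. f x \<partial>distr \<Omega> borel limit_point) = (\<integral>z. f (limit_point (snd z)) \<partial>(\<mu> \<Otimes>\<^sub>M \<Omega>))"
proof -
  interpret \<mu>: prob_space \<mu> by fact
  interpret pair: pair_prob_space \<mu> \<Omega> ..
  have "(\<integral>\<omega>. f (limit_point \<omega>) \<partial>distr (\<mu> \<Otimes>\<^sub>M \<Omega>) \<Omega> snd) = (\<integral>z. f (limit_point (snd z)) \<partial>(\<mu> \<Otimes>\<^sub>M \<Omega>))"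
    by (rule integral_distr) measurable
  moreover have "(\<integral>x. f x \<partial>distr \<Omega> borel limit_point) = (\<integral>\<omega>. f (limit_point \<omega>) \<partial>\<Omega>)"
    by (rule integral_distr) measurable
  ultimately show ?thesis by (simp only: pair.distr_pair_snd)
qed

text \<open>Dominated convergence in the coupling. No moment of \<mu> enters, since the iterates
  converge from every starting point.\<close>

lemma backward_law_converges_weakly:
  assumes P: "\<And>k. P (Suc k) = transition_kernel (M k) (T k)" and \<mu>: "\<mu> \<in> borel_prob_measures"
    and lim: "AE \<omega> in \<Omega>. \<forall>x. (\<lambda>n. backward_map n \<omega> x) \<longlonglongrightarrow> limit_point \<omega>"
  shows "converges_weakly (\<lambda>n. backward_law P n \<mu>) (distr \<Omega> borel limit_point)"
  unfolding converges_weakly_def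
proof (intro allI impI, elim conjE)
  fix f :: "'a \<Rightarrow> real" assume f: "continuous_on UNIV f" "bounded (range f)"
  then have [measurable]: "f \<in> borel_measurable borel" by (intro borel_measurable_continuous_onI)
  obtain K where K: "\<And>x. norm (f x) \<le> K" using f(2) by (auto simp: bounded_iff)
  interpret \<mu>: prob_space \<mu> using \<mu> by (simp add: borel_prob_measures_def)
  have [measurable_cong]: "sets \<mu> = sets borel" using \<mu> by (simp add: borel_prob_measures_def)
  interpret pair: pair_prob_space \<mu> \<Omega> ..
  have "AE z in \<mu> \<Otimes>\<^sub>M \<Omega>. \<forall>x. (\<lambda>n. backward_map n (snd z) x) \<longlonglongrightarrow> limit_point (snd z)"
  proof (rule AE_distrD[where f = snd and M' = \<Omega> and
        P = "\<lambda>\<omega>. \<forall>x. (\<lambda>n. backward_map n \<omega> x) \<longlonglongrightarrow> limit_point \<omega>"])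
    show "snd \<in> \<mu> \<Otimes>\<^sub>M \<Omega> \<rightarrow>\<^sub>M \<Omega>" by measurable
    show "AE \<omega> in distr (\<mu> \<Otimes>\<^sub>M \<Omega>) \<Omega> snd. \<forall>x. (\<lambda>n. backward_map n \<omega> x) \<longlonglongrightarrow> limit_point \<omega>"
      unfolding pair.distr_pair_snd by (rule lim)
  qed
  \<comment> \<open>The exceptional null set does not depend on the starting point, so the random
    start \<open>fst z\<close> may be inserted.\<close>
  then have ae: "AE z in \<mu> \<Otimes>\<^sub>M \<Omega>. (\<lambda>n. f (backward_map n (snd z) (fst z))) \<longlonglongrightarrow> f (limit_point (snd z))"
  proof eventually_elim
    case (elim z)
    then show ?case by (intro continuous_on_tendsto_compose[OF f(1)]) auto
  qed
  have "(\<lambda>n. \<integral>z. f (backward_map n (snd z) (fst z)) \<partial>(\<mu> \<Otimes>\<^sub>M \<Omega>)) \<longlonglongrightarrow> (\<integral>z. f (limit_point (snd z)) \<partial>(\<mu> \<Otimes>\<^sub>M \<Omega>))"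
  proof (rule integral_dominated_convergence[where w = "\<lambda>_. K"])
    show "integrable (\<mu> \<Otimes>\<^sub>M \<Omega>) (\<lambda>_. K)" by simp
    show "AE z in \<mu> \<Otimes>\<^sub>M \<Omega>. norm (f (backward_map n (snd z) (fst z))) \<le> K" for n by (intro AE_I2 K)
    show "AE z in \<mu> \<Otimes>\<^sub>M \<Omega>. (\<lambda>n. f (backward_map n (snd z) (fst z))) \<longlonglongrightarrow> f (limit_point (snd z))" by (rule ae)
  qed measurable
  then show "(\<lambda>n. \<integral>x. f x \<partial>backward_law P n \<mu>) \<longlonglongrightarrow> (\<integral>x. f x \<partial>distr \<Omega> borel limit_point)"
    by (simp add: integral_backward_law[OF P \<mu>] integral_law_limit_point[OF \<mu>.prob_space_axioms])
qed

text \<open>In the coupling, the iterate from \<open>x\<close> is compared with the iterate from 0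
  through \<open>lipschitz_prod n\<close>, and the latter with the limit through the geometric tail.
  Both \<open>s\<close>-th moments are of order \<open>q ^ n\<close>; the factor 2 comes from
  \<open>bounded_lipschitz_le_powr\<close>.\<close>

lemma d_BL_backward_law_le:
  assumes P: "\<And>k. P (Suc k) = transition_kernel (M k) (T k)" and \<mu>: "\<mu> \<in> borel_prob_measures_1"
    and lim: "AE \<omega> in \<Omega>. (\<lambda>n. backward_map n \<omega> 0) \<longlonglongrightarrow> limit_point \<omega>"
    and s: "0 < s" "s \<le> 1"
    and q: "0 \<le> q" "q < 1" "\<And>k. (\<integral>\<^sup>+\<theta>. ennreal (L k \<theta> powr s) \<partial>M k) = ennreal q"
    and B: "0 \<le> B" "\<And>m. m \<ge> n \<Longrightarrow> (\<integral>\<^sup>+\<theta>. ennreal (norm (T m \<theta> 0) powr s) \<partial>M m) \<le> ennreal B"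
  shows "d_BL (backward_law P n \<mu>) (distr \<Omega> borel limit_point)
       \<le> 2 * q ^ n * (1 + (\<integral>x. norm x \<partial>\<mu>) + B / (1 - q))"
proof (rule d_BL_leI)
  fix f :: "'a \<Rightarrow> real" assume f: "range f \<subseteq> {-1..1}" "1-lipschitz_on UNIV f"
  have [measurable]: "f \<in> borel_measurable borel"
    using f(2) by (intro borel_measurable_continuous_onI lipschitz_on_continuous_on)
  have f_le: "\<bar>f x\<bar> \<le> 1" for x using f(1) by (auto simp: abs_le_iff image_subset_iff)
  have \<mu>': "\<mu> \<in> borel_prob_measures" "(\<integral>\<^sup>+x. ennreal (norm x) \<partial>\<mu>) < \<infinity>"
    using \<mu> by (auto simp: borel_prob_measures_1_def)
  interpret \<mu>: prob_space \<mu> using \<mu>' by (simp add: borel_prob_measures_def)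
  have [measurable_cong]: "sets \<mu> = sets borel" using \<mu>' by (simp add: borel_prob_measures_def)
  interpret pair: pair_prob_space \<mu> \<Omega> ..
  have int: "integrable \<mu> (\<lambda>x. norm x)" using \<mu>'(2) by (intro integrableI_bounded) auto
  let ?Y = "\<lambda>z. backward_map n (snd z) (fst z)" and ?Z = "\<lambda>\<omega>. backward_map n \<omega> 0"
  have [simp]: "integrable (\<mu> \<Otimes>\<^sub>M \<Omega>) (\<lambda>z. f (?Y z))" "integrable (\<mu> \<Otimes>\<^sub>M \<Omega>) (\<lambda>z. f (limit_point (snd z)))"
    using f_le by (auto intro!: pair.integrable_const_bound[where B = 1])
  have "ennreal \<bar>(\<integral>x. f x \<partial>backward_law P n \<mu>) - (\<integral>x. f x \<partial>distr \<Omega> borel limit_point)\<bar>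
      = ennreal (norm (\<integral>z. f (?Y z) - f (limit_point (snd z)) \<partial>(\<mu> \<Otimes>\<^sub>M \<Omega>)))"
    by (simp add: integral_backward_law[OF P \<mu>'(1)] integral_law_limit_point[OF \<mu>.prob_space_axioms])
  also have "\<dots> \<le> (\<integral>\<^sup>+z. ennreal (norm (f (?Y z) - f (limit_point (snd z)))) \<partial>(\<mu> \<Otimes>\<^sub>M \<Omega>))"
    by (intro integral_norm_bound_ennreal) auto
  also have "\<dots> \<le> (\<integral>\<^sup>+z. 2 * (ennreal (lipschitz_prod n (snd z) powr s) * ennreal (norm (fst z) powr s)
      + ennreal (norm (?Z (snd z) - limit_point (snd z)) powr s)) \<partial>(\<mu> \<Otimes>\<^sub>M \<Omega>))"
  proof (intro nn_integral_mono)
    fix z assume "z \<in> space (\<mu> \<Otimes>\<^sub>M \<Omega>)"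
    then have \<omega>: "snd z \<in> space \<Omega>" by (auto simp: space_pair_measure)
    have "norm (?Y z - limit_point (snd z)) \<le> norm (?Y z - ?Z (snd z)) + norm (?Z (snd z) - limit_point (snd z))"
      using norm_triangle_ineq[of "?Y z - ?Z (snd z)" "?Z (snd z) - limit_point (snd z)"] by simp
    also have "\<dots> \<le> lipschitz_prod n (snd z) * norm (fst z) + norm (?Z (snd z) - limit_point (snd z))"
      using backward_map_lipschitz[OF \<omega>, of n "fst z" 0] by simp
    finally have "norm (?Y z - limit_point (snd z)) powr s
        \<le> (lipschitz_prod n (snd z) * norm (fst z) + norm (?Z (snd z) - limit_point (snd z))) powr s"
      using s by (intro powr_mono2) auto
    also have "\<dots> \<le> (lipschitz_prod n (snd z) * norm (fst z)) powr s + norm (?Z (snd z) - limit_point (snd z)) powr s"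
      using s lipschitz_prod_nonneg[OF \<omega>] by (intro powr_add_le_add_powr) auto
    also have "\<dots> = lipschitz_prod n (snd z) powr s * norm (fst z) powr s + norm (?Z (snd z) - limit_point (snd z)) powr s"
      using lipschitz_prod_nonneg[OF \<omega>] by (simp add: powr_mult)
    finally have "norm (f (?Y z) - f (limit_point (snd z)))
        \<le> 2 * (lipschitz_prod n (snd z) powr s * norm (fst z) powr s + norm (?Z (snd z) - limit_point (snd z)) powr s)"
      using bounded_lipschitz_le_powr[OF f s, of "?Y z" "limit_point (snd z)"] by simp
    from ennreal_leI[OF this]
    show "ennreal (norm (f (?Y z) - f (limit_point (snd z)))) \<le> 2 * (ennreal (lipschitz_prod n (snd z) powr s) * ennreal (norm (fst z) powr s)
      + ennreal (norm (?Z (snd z) - limit_point (snd z)) powr s))"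
      by (simp add: ennreal_mult)
  qed
  also have "\<dots> = 2 * ((\<integral>\<^sup>+z. ennreal (lipschitz_prod n (snd z) powr s) * ennreal (norm (fst z) powr s) \<partial>(\<mu> \<Otimes>\<^sub>M \<Omega>))
      + (\<integral>\<^sup>+z. ennreal (norm (?Z (snd z) - limit_point (snd z)) powr s) \<partial>(\<mu> \<Otimes>\<^sub>M \<Omega>)))"
    by (simp add: nn_integral_cmult nn_integral_add)
  also have "\<dots> \<le> 2 * (ennreal (q ^ n * (1 + (\<integral>x. norm x \<partial>\<mu>))) + ennreal (B * q ^ n / (1 - q)))"
  proof (intro mult_left_mono add_mono)
    have "(\<integral>\<^sup>+z. ennreal (norm (?Z (snd z) - limit_point (snd z)) powr s) \<partial>(\<mu> \<Otimes>\<^sub>M \<Omega>))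
        = (\<integral>\<^sup>+\<omega>. ennreal (norm (?Z \<omega> - limit_point \<omega>) powr s) \<partial>distr (\<mu> \<Otimes>\<^sub>M \<Omega>) \<Omega> snd)"
      by (subst nn_integral_distr) auto
    then show "(\<integral>\<^sup>+z. ennreal (norm (?Z (snd z) - limit_point (snd z)) powr s) \<partial>(\<mu> \<Otimes>\<^sub>M \<Omega>)) \<le> ennreal (B * q ^ n / (1 - q))"
      using nn_integral_dist_limit_point_powr_le[OF lim s q B] by (simp add: pair.distr_pair_snd)
    have "(\<integral>\<^sup>+z. ennreal (lipschitz_prod n (snd z) powr s) * ennreal (norm (fst z) powr s) \<partial>(\<mu> \<Otimes>\<^sub>M \<Omega>))
        = (\<integral>\<^sup>+\<omega>. ennreal (lipschitz_prod n \<omega> powr s) \<partial>\<Omega>) * (\<integral>\<^sup>+x. ennreal (norm x powr s) \<partial>\<mu>)"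
      by (subst pair.nn_integral_snd[symmetric]) (auto simp: nn_integral_cmult nn_integral_multc)
    \<comment> \<open>Replacing \<open>norm x powr s\<close> by \<open>1 + norm x\<close> turns the
      fractional moment of \<mu> into its first moment.\<close>
    also have "\<dots> \<le> ennreal q ^ n * (\<integral>\<^sup>+x. ennreal (1 + norm x) \<partial>\<mu>)"
      using s by (intro mult_mono nn_integral_mono ennreal_leI powr_le_one_plus)
        (auto simp: nn_integral_lipschitz_prod_powr[OF _ q(3)])
    also have "(\<integral>\<^sup>+x. ennreal (1 + norm x) \<partial>\<mu>) = ennreal (1 + (\<integral>x. norm x \<partial>\<mu>))"
      using int by (subst nn_integral_eq_integral) (auto simp: \<mu>.prob_space)
    finally show "(\<integral>\<^sup>+z. ennreal (lipschitz_prod n (snd z) powr s) * ennreal (norm (fst z) powr s) \<partial>(\<mu> \<Otimes>\<^sub>M \<Omega>))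
        \<le> ennreal (q ^ n * (1 + (\<integral>x. norm x \<partial>\<mu>)))"
      using q by (simp add: ennreal_mult ennreal_power integral_nonneg_AE)
  qed auto
  also have "\<dots> = ennreal (2 * (q ^ n * (1 + (\<integral>x. norm x \<partial>\<mu>)) + B * q ^ n / (1 - q)))"
  proof -
    have "2 * (ennreal a + ennreal b) = ennreal (2 * (a + b))" if "0 \<le> a" "0 \<le> b" for a b
      using that by (simp add: ennreal_mult ennreal_plus del: distrib_left_numeral)
    then show ?thesis using q B by (simp only: mult_nonneg_nonneg divide_nonneg_nonneg
          zero_le_power add_nonneg_nonneg zero_le_one integral_nonneg_AE AE_I2 norm_ge_zero diff_ge_0_iff_ge less_imp_le)
  qed
  also have "2 * (q ^ n * (1 + (\<integral>x. norm x \<partial>\<mu>)) + B * q ^ n / (1 - q))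
      = 2 * q ^ n * (1 + (\<integral>x. norm x \<partial>\<mu>) + B / (1 - q))"
    by (simp add: algebra_simps)
  finally show "\<bar>(\<integral>x. f x \<partial>backward_law P n \<mu>) - (\<integral>x. f x \<partial>distr \<Omega> borel limit_point)\<bar>
      \<le> 2 * q ^ n * (1 + (\<integral>x. norm x \<partial>\<mu>) + B / (1 - q))"
    using q B by (subst (asm) ennreal_le_iff) (auto intro!: mult_nonneg_nonneg add_nonneg_nonneg)
qed

end

section \<open>Affine transformations\<close>

text \<open>Continuity at 0 bounds \<open>T\<close> by 1 on a ball of radius \<open>d\<close>, and
  rescaling to norm \<open>d / 2\<close> extends the bound. Real homogeneity comes from
  \<open>scale_of_real\<close>. Boundedness is what makes \<open>onorm\<close> a genuine bound on
  the operator.\<close>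

lemma continuous_linear_operator_imp_bounded_linear:
  assumes "normed_space_over scl" and T: "continuous_linear_operator scl T"
  shows "bounded_linear T"
proof -
  interpret normed_space_over scl by fact
  interpret T: Vector_Spaces.linear scl scl T
    using T by (simp add: continuous_linear_operator_def)
  have scaleR: "T (r *\<^sub>R x) = r *\<^sub>R T x" for r x
    by (simp only: scale_of_real[symmetric] T.scale)
  have "isCont T 0"
    using T by (simp add: continuous_linear_operator_def continuous_on_eq_continuous_at)
  then have "\<forall>\<^sub>F x in at 0. dist (T x) (T 0) < 1"
    unfolding isCont_def by (rule tendstoD) simp
  then obtain d where d: "d > 0" "\<And>x. x \<noteq> 0 \<Longrightarrow> norm x < d \<Longrightarrow> norm (T x) < 1"
    by (auto simp: eventually_at T.zero)
  show ?thesis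
  proof (rule bounded_linear_intro)
    fix x
    show "norm (T x) \<le> norm x * (2 / d)"
    proof (cases "x = 0")
      case False
      then have "norm (T ((d / (2 * norm x)) *\<^sub>R x)) < 1"
        using d(1) by (intro d(2)) auto
      then show ?thesis using False d(1) by (simp add: scaleR field_simps)
    qed (simp add: T.zero)
  qed (simp_all add: T.add scaleR)
qed

text \<open>Both variables are positive, so a Borel set and its positive part have the same
  preimages. Agreement on subsets of the positive half-line thus determines the whole law.\<close>

lemma nn_integral_eq_of_same_law_on_positive:
  fixes X :: "'t \<Rightarrow> real" and Y :: "'u \<Rightarrow> real"
  assumes "prob_space M" "prob_space N" and [measurable]: "X \<in> borel_measurable M" "Y \<in> borel_measurable N"
    and pos: "\<And>t. t \<in> space M \<Longrightarrow> 0 < X t" "\<And>t. t \<in> space N \<Longrightarrow> 0 < Y t"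
    and eq: "\<And>E. E \<in> sets borel \<Longrightarrow> E \<subseteq> {0<..} \<Longrightarrow>
      measure M (X -` E \<inter> space M) = measure N (Y -` E \<inter> space N)"
    and [measurable]: "g \<in> borel_measurable borel"
  shows "(\<integral>\<^sup>+t. g (X t) \<partial>M) = (\<integral>\<^sup>+t. g (Y t) \<partial>N)"
proof -
  interpret M: prob_space M by fact
  interpret N: prob_space N by fact
  have "distr M borel X = distr N borel Y"
  proof (rule measure_eqI)
    fix E assume "E \<in> sets (distr M borel X)"
    then have E [measurable]: "E \<in> sets borel" by simp
    have "X -` E \<inter> space M = X -` (E \<inter> {0<..}) \<inter> space M" "Y -` E \<inter> space N = Y -` (E \<inter> {0<..}) \<inter> space N"
      using pos by auto
    then show "emeasure (distr M borel X) E = emeasure (distr N borel Y) E"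
      using eq[of "E \<inter> {0<..}"] by (simp add: emeasure_distr M.emeasure_eq_measure N.emeasure_eq_measure)
  qed simp
  moreover have "(\<integral>\<^sup>+t. g (X t) \<partial>M) = (\<integral>\<^sup>+x. g x \<partial>distr M borel X)"
    by (subst nn_integral_distr) auto
  moreover have "(\<integral>\<^sup>+t. g (Y t) \<partial>N) = (\<integral>\<^sup>+x. g x \<partial>distr N borel Y)"
    by (subst nn_integral_distr) auto
  ultimately show ?thesis by simp
qed

text \<open>Separability is expressed by \<open>second_countable_topology\<close>, which is
  equivalent to it in metric spaces. \<open>R\<close> and the supremum are extended nonnegative
  reals, so that their finiteness is a condition with content.\<close>

theorem proposition4p2:
  fixes scl :: "'k::real_normed_field \<Rightarrow> 'a::{banach, second_countable_topology} \<Rightarrow> 'a"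
    and \<Theta> :: "nat \<Rightarrow> 't measure"
    and \<AA> :: "nat \<Rightarrow> 't \<Rightarrow> 'a \<Rightarrow> 'a"
    and b :: "nat \<Rightarrow> 't \<Rightarrow> 'a"
    and L :: "nat \<Rightarrow> 't \<Rightarrow> real"
    and S :: "nat \<Rightarrow> 't \<Rightarrow> 'a \<Rightarrow> 'a"
    and P :: "nat \<Rightarrow> 'a \<Rightarrow> 'a set \<Rightarrow> ennreal"
    and R :: ennreal
    and n\<^sub>0 :: nat
  assumes X: "normed_space_over scl"
    and \<Theta>: "\<And>n. n \<ge> 1 \<Longrightarrow> prob_space (\<Theta> n)"
    and \<AA>: "\<And>n \<theta>. n \<ge> 1 \<Longrightarrow> \<theta> \<in> space (\<Theta> n) \<Longrightarrow> continuous_linear_operator scl (\<AA> n \<theta>)"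
    and L_pos: "\<And>n \<theta>. n \<ge> 1 \<Longrightarrow> \<theta> \<in> space (\<Theta> n) \<Longrightarrow> L n \<theta> > 0"
    and \<AA>_meas: "\<And>n. n \<ge> 1 \<Longrightarrow> (\<lambda>(x, \<theta>). \<AA> n \<theta> x) \<in> borel \<Otimes>\<^sub>M \<Theta> n \<rightarrow>\<^sub>M borel"
    and b_meas: "\<And>n. n \<ge> 1 \<Longrightarrow> b n \<in> \<Theta> n \<rightarrow>\<^sub>M borel"
    and L_meas: "\<And>n. n \<ge> 1 \<Longrightarrow> L n \<in> \<Theta> n \<rightarrow>\<^sub>M borel"
    and B1: "\<And>n \<theta>. n \<ge> 1 \<Longrightarrow> \<theta> \<in> space (\<Theta> n) \<Longrightarrow> onorm (\<AA> n \<theta>) \<le> L n \<theta>"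
    and B2_law: "\<And>E m n. E \<in> sets borel \<Longrightarrow> E \<subseteq> {0<..} \<Longrightarrow> m \<ge> 1 \<Longrightarrow> n \<ge> 1 \<Longrightarrow>
        measure (\<Theta> m) (L m -` E \<inter> space (\<Theta> m)) = measure (\<Theta> n) (L n -` E \<inter> space (\<Theta> n))"
    and R: "R = (\<integral>\<^sup>+\<theta>. ennreal (L 1 \<theta>) \<partial>\<Theta> 1)"
    and B2_R: "R < \<infinity>"
    and B2_ln: "ext_integral (\<Theta> 1) (\<lambda>\<theta>. ln (L 1 \<theta>)) < 0"
    and n\<^sub>0: "n\<^sub>0 \<ge> 1"
    and b_bound: "(SUP n\<in>{n\<^sub>0..}. \<integral>\<^sup>+\<theta>. ennreal (norm (b n \<theta>)) \<partial>\<Theta> n) < \<infinity>"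
    and S: "S = (\<lambda>n \<theta> x. \<AA> n \<theta> x + b n \<theta>)"
    and P: "P = (\<lambda>n. transition_kernel (\<Theta> n) (S n))"
  shows "\<exists>\<pi> \<in> borel_prob_measures. \<exists>x\<^sub>0 :: 'a. \<exists>q C :: real. 0 < q \<and> q < 1 \<and> 0 \<le> C \<and>
      (\<forall>\<mu> \<in> borel_prob_measures_1. \<forall>n\<ge>1.
         d_BL (backward_law P n \<mu>) \<pi> \<le> C * q ^ n * (1 + (\<integral>x. norm (x - x\<^sub>0) \<partial>\<mu>))) \<and>
      (\<forall>\<mu> \<in> borel_prob_measures. converges_weakly (\<lambda>n. backward_law P n \<mu>) \<pi>) \<and>
      (n\<^sub>0 = 1 \<and> R < 1 \<longrightarrow> \<pi> \<in> borel_prob_measures_1)"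
proof -
  have P_Suc: "P (Suc k) = transition_kernel (\<Theta> (Suc k)) (S (Suc k))" for k by (simp add: P)
  have \<AA>_blin: "bounded_linear (\<AA> (Suc k) \<theta>)" if "\<theta> \<in> space (\<Theta> (Suc k))" for k \<theta>
    using that by (intro continuous_linear_operator_imp_bounded_linear[OF X] \<AA>) auto
  interpret \<Theta>: prob_space "\<Theta> (Suc k)" for k using \<Theta> by simp
  interpret \<Theta>1: prob_space "\<Theta> 1" using \<Theta> by simp
  interpret product_prob_space "\<lambda>k. \<Theta> (Suc k)" UNIV ..
  interpret random_lipschitz_maps "\<lambda>k. \<Theta> (Suc k)" "\<lambda>k. S (Suc k)" "\<lambda>k. L (Suc k)"
  proof
    fix k
    have [measurable]: "(\<lambda>(x, \<theta>). \<AA> (Suc k) \<theta> x) \<in> borel \<Otimes>\<^sub>M \<Theta> (Suc k) \<rightarrow>\<^sub>M borel" "b (Suc k) \<in> \<Theta> (Suc k) \<rightarrow>\<^sub>M borel"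
      using \<AA>_meas b_meas by auto
    have "(\<lambda>z. (\<lambda>(x, \<theta>). \<AA> (Suc k) \<theta> x) z + b (Suc k) (snd z)) \<in> borel \<Otimes>\<^sub>M \<Theta> (Suc k) \<rightarrow>\<^sub>M borel"
      by measurable
    then show "(\<lambda>(x, \<theta>). S (Suc k) \<theta> x) \<in> borel \<Otimes>\<^sub>M \<Theta> (Suc k) \<rightarrow>\<^sub>M borel"
      by (simp add: S split_beta')
    show "L (Suc k) \<in> borel_measurable (\<Theta> (Suc k))" using L_meas by simp
    fix \<theta> x y assume \<theta>: "\<theta> \<in> space (\<Theta> (Suc k))"
    then show "0 \<le> L (Suc k) \<theta>" using L_pos[of "Suc k" \<theta>] by simp
    interpret bounded_linear "\<AA> (Suc k) \<theta>" using \<theta> by (rule \<AA>_blin)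
    have "norm (S (Suc k) \<theta> x - S (Suc k) \<theta> y) = norm (\<AA> (Suc k) \<theta> (x - y))"
      by (simp add: S diff)
    also have "\<dots> \<le> onorm (\<AA> (Suc k) \<theta>) * norm (x - y)" by (rule onorm) (rule bounded_linear_axioms)
    also have "\<dots> \<le> L (Suc k) \<theta> * norm (x - y)" using B1[of "Suc k" \<theta>] \<theta> by (intro mult_right_mono) auto
    finally show "norm (S (Suc k) \<theta> x - S (Suc k) \<theta> y) \<le> L (Suc k) \<theta> * norm (x - y)" .
  qed
  have L1 [measurable]: "L 1 \<in> borel_measurable (\<Theta> 1)" using L_meas by simp
  \<comment> \<open>Kept general in \<open>g\<close>, because the moments of exponent
    \<open>s\<close> and of exponent 1 are both transferred from index 1.\<close>
  have same_law: "(\<integral>\<^sup>+\<theta>. g (L (Suc k) \<theta>) \<partial>\<Theta> (Suc k)) = (\<integral>\<^sup>+\<theta>. g (L 1 \<theta>) \<partial>\<Theta> 1)"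
    if "g \<in> borel_measurable borel" for g :: "real \<Rightarrow> ennreal" and k
    using that L_pos L_meas
    by (intro nn_integral_eq_of_same_law_on_positive B2_law \<Theta>) auto

  obtain s where s: "0 < s" "s \<le> 1" "(\<integral>\<^sup>+\<theta>. ennreal (L 1 \<theta> powr s) \<partial>\<Theta> 1) < 1"
    using exists_powr_moment_less_one[OF \<Theta>1.prob_space_axioms L1] L_pos B2_R B2_ln R by auto
  define q\<^sub>0 where "q\<^sub>0 = enn2real (\<integral>\<^sup>+\<theta>. ennreal (L 1 \<theta> powr s) \<partial>\<Theta> 1)"
  have q\<^sub>0_eq: "(\<integral>\<^sup>+\<theta>. ennreal (L 1 \<theta> powr s) \<partial>\<Theta> 1) = ennreal q\<^sub>0"
    using s(3) unfolding q\<^sub>0_def by (intro ennreal_enn2real[symmetric]) (auto intro: less_trans)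
  have "0 \<le> q\<^sub>0" by (simp add: q\<^sub>0_def)
  with s(3) have q\<^sub>0: "0 \<le> q\<^sub>0" "q\<^sub>0 < 1"
    unfolding q\<^sub>0_eq by (simp_all flip: ennreal_1 add: ennreal_less_iff)
  have moment: "(\<integral>\<^sup>+\<theta>. ennreal (L (Suc k) \<theta> powr s) \<partial>\<Theta> (Suc k)) = ennreal q\<^sub>0" for k
    using same_law[of "\<lambda>x. ennreal (x powr s)" k] q\<^sub>0_eq by simp

  obtain c where c: "0 \<le> c" "(SUP n\<in>{n\<^sub>0..}. \<integral>\<^sup>+\<theta>. ennreal (norm (b n \<theta>)) \<partial>\<Theta> n) = ennreal c"
    using b_bound by (cases "SUP n\<in>{n\<^sub>0..}. \<integral>\<^sup>+\<theta>. ennreal (norm (b n \<theta>)) \<partial>\<Theta> n" rule: ennreal_cases) auto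
  have S_0: "S (Suc k) \<theta> 0 = b (Suc k) \<theta>" if "\<theta> \<in> space (\<Theta> (Suc k))" for k \<theta>
    using linear_0[OF bounded_linear.linear[OF \<AA>_blin[OF that]]] by (simp add: S)
  have drift: "(\<integral>\<^sup>+\<theta>. ennreal (norm (S (Suc k) \<theta> 0)) \<partial>\<Theta> (Suc k)) \<le> ennreal c" if "n\<^sub>0 \<le> Suc k" for k
  proof -
    have "(\<integral>\<^sup>+\<theta>. ennreal (norm (S (Suc k) \<theta> 0)) \<partial>\<Theta> (Suc k)) = (\<integral>\<^sup>+\<theta>. ennreal (norm (b (Suc k) \<theta>)) \<partial>\<Theta> (Suc k))"
      by (intro nn_integral_cong) (simp add: S_0)
    also have "\<dots> \<le> (SUP n\<in>{n\<^sub>0..}. \<integral>\<^sup>+\<theta>. ennreal (norm (b n \<theta>)) \<partial>\<Theta> n)"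
      using that by (intro SUP_upper) auto
    finally show ?thesis by (simp add: c)
  qed
  \<comment> \<open>The shift by one accounts for the indexing from 0: the map with index
    \<open>k\<close> is \<open>S (Suc k)\<close>, whose translation is controlled once
    \<open>n\<^sub>0 \<le> Suc k\<close>.\<close>
  define N where "N = n\<^sub>0 - 1"
  have drift_powr: "(\<integral>\<^sup>+\<theta>. ennreal (norm (S (Suc k) \<theta> 0) powr s) \<partial>\<Theta> (Suc k)) \<le> ennreal (1 + c)" if "N \<le> k" for k
  proof -
    have [measurable]: "(\<lambda>\<theta>. S (Suc k) \<theta> 0) \<in> borel_measurable (\<Theta> (Suc k))" by measurable
    have "(\<integral>\<^sup>+\<theta>. ennreal (norm (S (Suc k) \<theta> 0) powr s) \<partial>\<Theta> (Suc k))
        \<le> (\<integral>\<^sup>+\<theta>. 1 + ennreal (norm (S (Suc k) \<theta> 0)) \<partial>\<Theta> (Suc k))"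
    proof (intro nn_integral_mono)
      fix \<theta>
      show "ennreal (norm (S (Suc k) \<theta> 0) powr s) \<le> 1 + ennreal (norm (S (Suc k) \<theta> 0))"
        using ennreal_leI[OF powr_le_one_plus[OF norm_ge_zero s(1,2)]] by simp
    qed
    also have "\<dots> = 1 + (\<integral>\<^sup>+\<theta>. ennreal (norm (S (Suc k) \<theta> 0)) \<partial>\<Theta> (Suc k))"
      by (simp add: nn_integral_add \<Theta>.emeasure_space_1)
    also have "\<dots> \<le> 1 + ennreal c"
      using that by (intro add_left_mono drift) (simp add: N_def)
    finally show ?thesis using c(1) by simp
  qed

  have lim: "AE \<omega> in \<Omega>. \<forall>x. (\<lambda>n. backward_map n \<omega> x) \<longlonglongrightarrow> limit_point \<omega>"
    using c(1) by (intro AE_backward_map_tendsto[OF s(1,2) q\<^sub>0 moment _ drift_powr]) auto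
  then have lim0: "AE \<omega> in \<Omega>. (\<lambda>n. backward_map n \<omega> 0) \<longlonglongrightarrow> limit_point \<omega>" by eventually_elim simp
  define \<pi> where "\<pi> = distr \<Omega> borel limit_point"
  have \<pi>: "\<pi> \<in> borel_prob_measures"
    unfolding \<pi>_def borel_prob_measures_def by (auto intro!: P.prob_space_distr)
  have law: "backward_law P n \<mu> \<in> borel_prob_measures" if \<mu>: "\<mu> \<in> borel_prob_measures" for n \<mu>
  proof -
    interpret \<mu>: prob_space \<mu> using \<mu> by (simp add: borel_prob_measures_def)
    have [measurable_cong]: "sets \<mu> = sets borel" using \<mu> by (simp add: borel_prob_measures_def)
    interpret pair: pair_prob_space \<mu> \<Omega> ..
    show ?thesis
      unfolding backward_law_eq_distr[OF P_Suc \<mu>] borel_prob_measures_def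
      by (auto intro!: pair.prob_space_distr)
  qed
  \<comment> \<open>\<open>q\<^sub>0\<close> has only been shown nonnegative. The midpoint between
    it and 1 is a positive rate that still dominates it, and division by \<open>q ^ N\<close>
    becomes possible.\<close>
  define q where "q = (1 + q\<^sub>0) / 2"
  have q: "0 < q" "q < 1" "q\<^sub>0 \<le> q" using q\<^sub>0 by (auto simp: q_def)
  \<comment> \<open>The tail term \<open>B / (1 - q)\<close> of \<open>d_BL_backward_law_le\<close>
    with \<open>B = 1 + c\<close> and rate \<open>q\<^sub>0\<close>.\<close>
  define e where "e = (1 + c) / (1 - q\<^sub>0)"
  have e: "0 \<le> e" using q\<^sub>0 c(1) by (simp add: e_def)
  \<comment> \<open>Chosen so that \<open>1 + m + e \<le> D * (1 + m)\<close> for every nonnegative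
    first moment \<open>m\<close>.\<close>
  define D where "D = 1 + e"
  have D: "1 \<le> D" using e by (simp add: D_def)
  \<comment> \<open>The division by \<open>q ^ N\<close> makes \<open>C * q ^ n\<close> at least 2
    for \<open>n < N\<close>, so that the trivial bound \<open>d_BL_le_2\<close> covers the early
    indices.\<close>
  define C where "C = 2 * D / q ^ N"
  have qN: "q ^ N \<le> 1" "0 < q ^ N" using q by (auto intro: power_le_one)
  have C: "2 * D \<le> C" using D q qN by (simp add: C_def field_simps)
  \<comment> \<open>The reference point is the origin; \<open>x - 0\<close> is kept to match the
    existential statement.\<close>
  have "d_BL (backward_law P n \<mu>) \<pi> \<le> C * q ^ n * (1 + (\<integral>x. norm (x - 0) \<partial>\<mu>))"
    if \<mu>: "\<mu> \<in> borel_prob_measures_1" for n \<mu>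
  proof (cases "N \<le> n")
    case True
    define m where "m = (\<integral>x. norm x \<partial>\<mu>)"
    have m: "0 \<le> m" by (simp add: m_def)
    have "d_BL (backward_law P n \<mu>) \<pi> \<le> 2 * q\<^sub>0 ^ n * (1 + m + e)"
      unfolding \<pi>_def m_def e_def using c(1) True
      by (intro d_BL_backward_law_le[OF P_Suc \<mu> lim0 s(1,2) q\<^sub>0 moment _ drift_powr]) auto
    also have "\<dots> \<le> 2 * q ^ n * (D * (1 + m))"
    proof (intro mult_mono power_mono)
      show "1 + m + e \<le> D * (1 + m)"
        using e m by (simp add: D_def algebra_simps)
    qed (use q q\<^sub>0 e m in auto)
    also have "\<dots> = 2 * D * q ^ n * (1 + m)" by simp
    also have "\<dots> \<le> C * q ^ n * (1 + m)"
      using C q m by (intro mult_right_mono) auto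
    finally show ?thesis by (simp add: m_def)
  next
    case False
    have "d_BL (backward_law P n \<mu>) \<pi> \<le> 2 * 1 * 1"
      using \<mu> by (simp add: d_BL_le_2 law \<pi> borel_prob_measures_1_def)
    also have "\<dots> \<le> 2 * D * (q ^ n / q ^ N)"
      using D q False qN by (intro mult_mono) (auto intro!: power_decreasing simp: le_divide_eq)
    also have "\<dots> = C * q ^ n * 1" by (simp add: C_def)
    also have "\<dots> \<le> C * q ^ n * (1 + (\<integral>x. norm (x - 0) \<partial>\<mu>))"
      using C D q by (intro mult_left_mono) auto
    finally show ?thesis .
  qed
  moreover have "converges_weakly (\<lambda>n. backward_law P n \<mu>) \<pi>" if "\<mu> \<in> borel_prob_measures" for \<mu>
    unfolding \<pi>_def by (rule backward_law_converges_weakly[OF P_Suc that lim])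
  moreover have "\<pi> \<in> borel_prob_measures_1" if "n\<^sub>0 = 1" "R < 1"
  proof -
    obtain r where r: "0 \<le> r" "R = ennreal r" using B2_R by (cases R rule: ennreal_cases) auto
    have "(\<integral>\<^sup>+\<theta>. ennreal (L (Suc k) \<theta> powr 1) \<partial>\<Theta> (Suc k)) = ennreal r" for k
    proof -
      have "(\<integral>\<^sup>+\<theta>. ennreal (L 1 \<theta> powr 1) \<partial>\<Theta> 1) = R"
        unfolding R using L_pos by (intro nn_integral_cong) (simp add: less_imp_le)
      then show ?thesis using same_law[of "\<lambda>x. ennreal (x powr 1)" k] r by simp
    qed
    moreover have "r < 1" using \<open>R < 1\<close> r by simp
    \<comment> \<open>With \<open>s = 1\<close> and \<open>n = 0\<close> the iterate is the origin
      itself, so the distance is the norm of the limit. The condition \<open>n\<^sub>0 = 1\<close>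
      makes the bound \<open>c\<close> valid for every index.\<close>
    ultimately have "(\<integral>\<^sup>+\<omega>. ennreal (norm (backward_map 0 \<omega> 0 - limit_point \<omega>) powr 1) \<partial>\<Omega>) \<le> ennreal (c * r ^ 0 / (1 - r))"
      using drift c(1) r(1) \<open>n\<^sub>0 = 1\<close> by (intro nn_integral_dist_limit_point_powr_le[OF lim0]) auto
    then have "(\<integral>\<^sup>+\<omega>. ennreal (norm (limit_point \<omega>)) \<partial>\<Omega>) < \<infinity>"
      by (auto intro: le_less_trans)
    then have "(\<integral>\<^sup>+x. ennreal (norm x) \<partial>\<pi>) < \<infinity>"
      unfolding \<pi>_def by (subst nn_integral_distr) auto
    with \<pi> show ?thesis by (simp add: borel_prob_measures_1_def)
  qed
  moreover have "0 \<le> C" using C D by linarith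
  ultimately show ?thesis using \<pi> q by blast
qed

end
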